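(* Keep the per-unit information fixed and let $n\to\infty$, with fixed (frequentist-frame) primary parameters $\theta^\star=\theta^\star_n$ and nuisance parameters $\nu^\star=(\nu_1^\star,\dots,\nu_n^\star)\in\mathcal V^n$. Suppose Assumptions 1, 2, 3 and 4 hold. Writing $\nu^\star_{n,-i}=(\nu_1^\star,\dots,\nu_{i-1}^\star,\nu_{i+1}^\star,\dots,\nu_n^\star)$ and $G(\nu^\star_{n,-i}):=\frac{1}{n-1}\sum_{j\ne i}\delta_{\nu_j^\star}$, assume $$\max_{i=1,\dots,n}\mathbb E_{\nu^\star_{n,-i}}\Big[\mathfrak D_{\mathrm{BL}}\big(G_\Pi[U_1,\dots,U_{i-1},U_{i+1},\dots,U_n],\,G(\nu^\star_{n,-i})\big)\Big]\to0\quad\text{as }n\to\infty.$$ Then $P_1,\dots,P_n$ are asymptotic compound p-values: $$\limsup_{n\to\infty}\sup_{\alpha\in[0,1]}\Big(\frac1n\sum_{i\in\mathcal H_0}\mathbb P_{\nu^\star,\theta^\star}(P_i\le\alpha)-\alpha\Big)_+\le0.$$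
   Context: Setup: for units $i=1,\dots,n$, the data of unit $i$ are summarized by $T_i\in\mathbb R$ and $U_i\in\mathcal U$. Unit $i$ has a primary parameter $\theta_i$ and nuisance parameter $\nu_i\in\mathcal V$. Conditionally on parameters, the pairs $(T_i,U_i)$ are independent, with law depending only on $(\theta_i,\nu_i)$ through a common kernel, and the law of $U_i$ depends only on $\nu_i$. The hierarchical model used for inference posits $\nu_i\mid G$ i.i.d. $G$, $G\sim\Pi$. A null value $\theta_0$ is fixed, $\mathcal H_0=\{i:\theta_i^\star=\theta_0\}$. $P_i:=\mathfrak P_i(T_i,(U_1,\dots,U_n);\Pi)$ with $\mathfrak P_i(t,(u_1,\dots,u_n);\Pi):=\mathbb P_\Pi(|T_i|\ge|t|\mid U_1=u_1,\dots,U_n=u_n)$ under the joint hierarchical law with $\theta_i=\theta_0$. $P^{\mathrm{or}}(t,u,\nu):=\mathbb P(|T_i|\ge|t|\mid U_i=u,\nu_i=\nu)$ under $\theta_i=\theta_0$. Posterior mean from $m$ units: $G_\Pi[u_1,\dots,u_m](A):=\mathbb E_\Pi[G(A)\mid U_1=u_1,\dots,U_m=u_m]$. $\mathfrak D_{\mathrm{BL}}(G,G'):=\sup\{|\int\psi\,dG-\int\psi\,dG'|:\|\psi\|_\infty\le1,\ \psi\text{ 1-Lipschitz}\}$. $\mathbb P_{\nu^\star,\theta^\star}$ and $\mathbb E_{\nu^\star_{n,-i}}$ denote probability/expectation with parameters fixed and only data random ($\mathbb E_{\nu^\star_{n,-i}}$ over $(U_j)_{j\ne i}$). Assumption 1: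 for all $\nu,u$, the conditional law of $T_i$ given $\nu_i=\nu,U_i=u$ (under $\theta_i=\theta_0$) is absolutely continuous w.r.t. Lebesgue measure. Assumption 2: $\mathcal V$ is a compact metric space with metric $d$. Assumption 3: the family $\nu\mapsto P^{\mathrm{or}}(t,u,\nu)$, indexed by $t\in\mathbb R,u\in\mathcal U$, is uniformly equicontinuous on $\mathcal V$. Assumption 4: the family $\{\mathbb P(U_i\in\cdot\mid\nu_i=\nu):\nu\in\mathcal V\}$ is tight, all its members have densities $p(u\mid\nu)$ w.r.t. a measure $\lambda$ on $\mathcal U$, and for every compact $C\subset\mathcal U$, $\lambda(C)<\infty$ and $\{\nu\mapsto p(u\mid\nu):u\in C\}$ is uniformly bounded and equicontinuous. *)

theory Defs
  imports "HOL-Probability.Probability"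
begin

definition Qlaw :: "'u measure \<Rightarrow> ('u \<Rightarrow> 'v \<Rightarrow> real) \<Rightarrow> 'v \<Rightarrow> 'u measure" where
  "Qlaw lam p \<nu> = density lam (\<lambda>u. ennreal (p u \<nu>))"

text \<open>Joint law of (T_i, U_i) given (theta_i, nu_i): U ~ Q nu, then T | U = u ~ F theta nu u.\<close>
definition data_law :: "'u::topological_space measure \<Rightarrow> ('u \<Rightarrow> 'v \<Rightarrow> real)
    \<Rightarrow> ('th \<Rightarrow> 'v \<Rightarrow> 'u \<Rightarrow> real measure) \<Rightarrow> 'th \<Rightarrow> 'v \<Rightarrow> (real \<times> 'u) measure" where
  "data_law lam p F \<theta> \<nu> =
     bind (Qlaw lam p \<nu>) (\<lambda>u. distr (F \<theta> \<nu> u) ((borel :: real measure) \<Otimes>\<^sub>M (borel :: 'u measure)) (\<lambda>t. (t, u)))"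

text \<open>Oracle p-value P^or(t,u,nu) = P(|T_i| >= |t| | U_i = u, nu_i = nu) under theta_i = theta_0.\<close>
definition Por :: "('th \<Rightarrow> 'v \<Rightarrow> 'u \<Rightarrow> real measure) \<Rightarrow> 'th \<Rightarrow> real \<Rightarrow> 'u \<Rightarrow> 'v \<Rightarrow> real" where
  "Por F \<theta>0 t u \<nu> = measure (F \<theta>0 \<nu> u) {s. \<bar>t\<bar> \<le> \<bar>s\<bar>}"

definition marg :: "('u \<Rightarrow> 'v \<Rightarrow> real) \<Rightarrow> 'v measure \<Rightarrow> 'u \<Rightarrow> real" where
  "marg p G u = (\<integral>\<nu>. p u \<nu> \<partial>G)"

definition lik :: "('u \<Rightarrow> 'v \<Rightarrow> real) \<Rightarrow> 'v measure \<Rightarrow> nat set \<Rightarrow> (nat \<Rightarrow> 'u) \<Rightarrow> real" where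
  "lik p G J u = (\<Prod>j\<in>J. marg p G (u j))"

text \<open>Posterior mean G_Pi[u_J](A) = E_Pi[G(A) | U_j = u_j, j in J] (Bayes formula), as a measure.\<close>
definition post_mean :: "'v measure measure \<Rightarrow> ('u \<Rightarrow> 'v \<Rightarrow> real) \<Rightarrow> nat set \<Rightarrow> (nat \<Rightarrow> 'u) \<Rightarrow> 'v measure" where
  "post_mean Prior p J u =
     bind (density Prior (\<lambda>G. ennreal (lik p G J u / (\<integral>G'. lik p G' J u \<partial>Prior)))) (\<lambda>G. G)"

text \<open>The p-value function P_i(t, (u_0..u_{n-1}); Prior) for units 0..n-1:
  P_Pi(|T_i| >= |t| | U = u) under the hierarchical model with theta_i = theta_0 (Bayes formula).\<close>
definition pval :: "'v measure measure \<Rightarrow> ('u \<Rightarrow> 'v \<Rightarrow> real) \<Rightarrow> ('th \<Rightarrow> 'v \<Rightarrow> 'u \<Rightarrow> real measure)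
    \<Rightarrow> 'th \<Rightarrow> nat \<Rightarrow> nat \<Rightarrow> real \<Rightarrow> (nat \<Rightarrow> 'u) \<Rightarrow> real" where
  "pval Prior p F \<theta>0 n i t u =
     (\<integral>G. (\<integral>\<nu>. Por F \<theta>0 t (u i) \<nu> * p (u i) \<nu> \<partial>G) * lik p G ({..<n} - {i}) u \<partial>Prior)
     / (\<integral>G. lik p G {..<n} u \<partial>Prior)"

definition DBL :: "'v::metric_space measure \<Rightarrow> 'v measure \<Rightarrow> real" where
  "DBL G G' = (SUP \<psi> \<in> {\<psi>. (\<forall>x. \<bar>\<psi> x\<bar> \<le> 1) \<and> (\<forall>x y. \<bar>\<psi> x - \<psi> y\<bar> \<le> dist x y)}.
                 \<bar>(\<integral>x. \<psi> x \<partial>G) - (\<integral>x. \<psi> x \<partial>G')\<bar>)"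

definition emp_others :: "(nat \<Rightarrow> 'v) \<Rightarrow> nat \<Rightarrow> nat \<Rightarrow> 'v measure" where
  "emp_others \<nu> n i = measure_pmf (map_pmf \<nu> (pmf_of_set ({..<n} - {i})))"

definition post_err :: "'u measure \<Rightarrow> ('u \<Rightarrow> 'v::metric_space \<Rightarrow> real) \<Rightarrow> 'v measure measure
    \<Rightarrow> (nat \<Rightarrow> 'v) \<Rightarrow> nat \<Rightarrow> nat \<Rightarrow> real" where
  "post_err lam p Prior \<nu> n i =
     (\<integral>u. DBL (post_mean Prior p ({..<n} - {i}) u) (emp_others \<nu> n i)
        \<partial>(PiM ({..<n} - {i}) (\<lambda>j. Qlaw lam p (\<nu> j))))"

definition rej_prob :: "'u::topological_space measure \<Rightarrow> ('u \<Rightarrow> 'v \<Rightarrow> real) \<Rightarrow> ('th \<Rightarrow> 'v \<Rightarrow> 'u \<Rightarrow> real measure)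
    \<Rightarrow> 'th \<Rightarrow> 'v measure measure \<Rightarrow> (nat \<Rightarrow> 'th) \<Rightarrow> (nat \<Rightarrow> 'v) \<Rightarrow> nat \<Rightarrow> nat \<Rightarrow> real \<Rightarrow> real" where
  "rej_prob lam p F \<theta>0 Prior \<theta> \<nu> n i \<alpha> =
     (let D = PiM {..<n} (\<lambda>j. data_law lam p F (\<theta> j) (\<nu> j)) in
      measure D {\<omega> \<in> space D. pval Prior p F \<theta>0 n i (fst (\<omega> i)) (\<lambda>j. snd (\<omega> j)) \<le> \<alpha>})"

end

theory Submission
  imports Defs
begin

text \<open>
  Let \<open>G\<^sub>n\<close> be the empirical measure of the true nuisance parameters. For any data law, the p-values
  computed with \<open>G\<^sub>n\<close> in place of the posterior mean are exactly compound p-values: given \<open>U = u\<close>, the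
  average over the units is the probability, under a mixture with weights proportional to
  \<open>p(u | \<nu>\<^sub>j)\<close>, that the tail function of \<open>|T|\<close> evaluated at \<open>|T|\<close> is at most \<open>\<alpha>\<close>.

  On a compact set of values \<open>u\<close>, the integrands \<open>P\<^sup>o\<^sup>r p\<close> and \<open>p\<close> are uniformly bounded and
  equicontinuous in \<open>\<nu>\<close>, hence uniformly close to Lipschitz functions with one constant, so a small
  bounded Lipschitz distance makes numerator and denominator of the Bayes formula close to those for
  \<open>G\<^sub>n\<close>. The quotients are then close unless the mixture density at \<open>U\<^sub>i\<close> is below \<open>\<eta>\<close>. Averaged over
  \<open>i\<close>, the law of \<open>U\<^sub>i\<close> has exactly this mixture density, so that event has average probability at most
  \<open>\<eta>\<close> times the reference measure of the compact set. Tightness and Markov's inequality handle the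
  remaining exceptional events, and a union bound suffices: independence of the units is used only to
  identify the marginal laws.
\<close>

section \<open>Super-uniformity of a weighted tail function evaluated at its own argument\<close>

text \<open>\<open>S\<close> is decreasing in the absolute value of its argument, so its level set
  lies in a closed or an open tail set starting at the infimum \<open>b\<close> of the absolute
  values in it. The weighted mass of a tail set starting at a point of the level set is a value of
  \<open>S\<close>, hence at most \<open>a\<close>; continuity from below covers an infimum that is
  not attained.\<close>

lemma sum_tail_level_le:
  fixes M :: "'j \<Rightarrow> real measure" and c :: "'j \<Rightarrow> real"
  assumes fin: "finite J" and M: "\<And>j. j \<in> J \<Longrightarrow> finite_measure (M j)"
    and sets: "\<And>j. j \<in> J \<Longrightarrow> sets (M j) = sets borel"
    and c: "\<And>j. j \<in> J \<Longrightarrow> 0 \<le> c j" and a: "0 \<le> a"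
  defines "S \<equiv> \<lambda>t. \<Sum>j\<in>J. c j * measure (M j) {s. \<bar>t\<bar> \<le> \<bar>s\<bar>}"
  shows "(\<Sum>j\<in>J. c j * measure (M j) {t. S t \<le> a}) \<le> a"
proof -
  define B where "B = {t. S t \<le> a}"
  have meas: "{s. b \<le> \<bar>s\<bar>} \<in> sets (M j)" "{s. b < \<bar>s\<bar>} \<in> sets (M j)" if "j \<in> J" for j b
    by (simp_all add: sets[OF that])
  \<comment> \<open>A non-measurable set has measure 0, so monotonicity holds whether or not the
    smaller set is known to be measurable.\<close>
  have mono: "(\<Sum>j\<in>J. c j * measure (M j) B) \<le> (\<Sum>j\<in>J. c j * measure (M j) B')"
    if "B \<subseteq> B'" "\<And>j. j \<in> J \<Longrightarrow> B' \<in> sets (M j)" for B B'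
    using that by (intro sum_mono mult_left_mono c finite_measure.finite_measure_mono[OF M]) auto
  \<comment> \<open>Either the level set is empty, or the infimum of the absolute values is attained
    at some \<open>t\<close>, or it is not attained.\<close>
  consider "B = {}" | t where "t \<in> B" "\<And>s. s \<in> B \<Longrightarrow> \<bar>t\<bar> \<le> \<bar>s\<bar>"
    | "B \<noteq> {}" "\<And>t. t \<in> B \<Longrightarrow> \<exists>s\<in>B. \<bar>s\<bar> < \<bar>t\<bar>"
    by (metis equals0I not_le)
  then have "(\<Sum>j\<in>J. c j * measure (M j) B) \<le> a"
  proof cases
    case 1
    then show ?thesis using a by simp
  next
    case 2
    have "(\<Sum>j\<in>J. c j * measure (M j) B) \<le> S t"
      unfolding S_def using 2 by (intro mono meas) auto
    also have "S t \<le> a" using 2 by (simp add: B_def)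
    finally show ?thesis .
  next
    case 3
    define b where "b = Inf (abs ` B)"
    have bdd: "bdd_below (abs ` B)" by (intro bdd_belowI[of _ 0]) auto
    have less: "b < \<bar>t\<bar>" if t: "t \<in> B" for t
    proof -
      obtain s where "s \<in> B" "\<bar>s\<bar> < \<bar>t\<bar>" using 3(2)[OF t] by blast
      then show ?thesis using cInf_lower[of "\<bar>s\<bar>" "abs ` B"] bdd by (auto simp: b_def)
    qed
    \<comment> \<open>Closed tails that increase to the open tail at \<open>b\<close>. Each starts
      strictly above the infimum, so it is contained in the tail of some point of the level
      set.\<close>
    define C where "C k = {s. b + 1 / Suc k \<le> \<bar>s\<bar>}" for k
    have inc: "incseq C"
    proof (rule monoI)
      fix m n :: nat assume "m \<le> n"
      then have "1 / real (Suc n) \<le> 1 / real (Suc m)" by (simp add: frac_le)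
      then show "C m \<le> C n" by (auto simp: C_def simp del: of_nat_Suc)
    qed
    have C_le: "(\<Sum>j\<in>J. c j * measure (M j) (C k)) \<le> a" for k
    proof -
      have "\<exists>t\<in>B. \<bar>t\<bar> < b + 1 / Suc k"
        using cInf_lessD[of "abs ` B" "b + 1 / Suc k"] 3(1) by (auto simp: b_def)
      then obtain t where t: "t \<in> B" "\<bar>t\<bar> < b + 1 / Suc k" by blast
      then have "(\<Sum>j\<in>J. c j * measure (M j) (C k)) \<le> S t"
        unfolding S_def by (intro mono meas) (auto simp: C_def)
      also have "S t \<le> a" using t by (simp add: B_def)
      finally show ?thesis .
    qed
    have UN: "(\<Union>k. C k) = {s. b < \<bar>s\<bar>}"
    proof (intro set_eqI iffI)
      fix s assume "s \<in> {s. b < \<bar>s\<bar>}"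
      then obtain k where "1 / Suc k < \<bar>s\<bar> - b"
        using reals_Archimedean[of "\<bar>s\<bar> - b"] by (auto simp: inverse_eq_divide)
      then have "s \<in> C k" by (simp add: C_def)
      then show "s \<in> (\<Union>k. C k)" by blast
    next
      fix s assume "s \<in> (\<Union>k. C k)"
      then obtain k where "b + 1 / Suc k \<le> \<bar>s\<bar>" by (auto simp: C_def)
      moreover have "0 < 1 / real (Suc k)" by simp
      ultimately have "b < \<bar>s\<bar>" by linarith
      then show "s \<in> {s. b < \<bar>s\<bar>}" by simp
    qed
    have "(\<lambda>k. \<Sum>j\<in>J. c j * measure (M j) (C k)) \<longlonglongrightarrow> (\<Sum>j\<in>J. c j * measure (M j) (\<Union>k. C k))"
      using inc meas(1) unfolding C_def
      by (intro tendsto_intros finite_measure.finite_Lim_measure_incseq[OF M]) auto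
    then have "(\<Sum>j\<in>J. c j * measure (M j) {s. b < \<bar>s\<bar>}) \<le> a"
      unfolding UN by (rule LIMSEQ_le_const2) (use C_le in auto)
    moreover have "(\<Sum>j\<in>J. c j * measure (M j) B) \<le> (\<Sum>j\<in>J. c j * measure (M j) {s. b < \<bar>s\<bar>})"
      using less by (intro mono meas) auto
    ultimately show ?thesis by simp
  qed
  then show ?thesis by (simp add: B_def)
qed

subsection \<open>The bounded Lipschitz distance\<close>

text \<open>Inf-convolution with a cone of slope \<open>2 * B / \<delta>\<close>. Beyond distance
  \<open>\<delta>\<close> the penalty is at least the largest possible oscillation
  \<open>2 * B\<close> of \<open>h\<close>, so only points within \<open>\<delta>\<close>, where
  \<open>h\<close> varies by at most \<open>\<epsilon>\<close>, can bring the infimum below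
  \<open>h x\<close>.\<close>

lemma lipschitz_approximation:
  fixes h :: "'v::metric_space \<Rightarrow> real"
  assumes B: "\<And>x. \<bar>h x\<bar> \<le> B" and \<delta>: "0 < \<delta>"
    and unif: "\<And>x y. dist x y < \<delta> \<Longrightarrow> \<bar>h x - h y\<bar> \<le> \<epsilon>"
  obtains g where "\<And>x. \<bar>g x\<bar> \<le> B" "\<And>x y. \<bar>g x - g y\<bar> \<le> 2 * B / \<delta> * dist x y"
    "\<And>x. \<bar>h x - g x\<bar> \<le> \<epsilon>"
proof -
  define L where "L = 2 * B / \<delta>"
  have B0: "0 \<le> B" using B[of undefined] by linarith
  have L0: "0 \<le> L" using B0 \<delta> by (simp add: L_def)
  \<comment> \<open>The largest \<open>L\<close>-Lipschitz function below \<open>h\<close>.\<close>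
  define g where "g x = (INF y. h y + L * dist x y)" for x
  have low: "- B \<le> h y + L * dist x y" for x y
    using B[of y] L0 mult_nonneg_nonneg[OF L0 zero_le_dist[of x y]] by linarith
  have bdd: "bdd_below (range (\<lambda>y. h y + L * dist x y))" for x
    using low by (intro bdd_belowI[of _ "-B"]) auto
  have g_le: "g x \<le> h y + L * dist x y" for x y
    unfolding g_def by (rule cINF_lower[OF bdd]) simp
  have g_ge: "z \<le> g x" if "\<And>y. z \<le> h y + L * dist x y" for x z
    unfolding g_def by (rule cINF_greatest) (use that in auto)
  have lip: "g x - g y \<le> L * dist x y" for x y
  proof -
    have "g x - L * dist x y \<le> g y"
    proof (rule g_ge)
      fix z
      have "L * dist x z \<le> L * (dist x y + dist y z)" by (intro mult_left_mono dist_triangle L0)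
      then show "g x - L * dist x y \<le> h z + L * dist y z"
        using g_le[of x z] by (simp add: distrib_left)
    qed
    then show ?thesis by simp
  qed
  show thesis
  proof
    fix x y
    show "\<bar>g x\<bar> \<le> B" using g_ge[of "-B" x] low g_le[of x x] B[of x] by (auto simp: abs_le_iff)
    show "\<bar>g x - g y\<bar> \<le> 2 * B / \<delta> * dist x y"
      using lip[of x y] lip[of y x] by (simp add: L_def dist_commute abs_le_iff)
    have "h x - \<epsilon> \<le> g x"
    proof (rule g_ge)
      fix y show "h x - \<epsilon> \<le> h y + L * dist x y"
      proof (cases "dist x y < \<delta>")
        case True
        then show ?thesis using unif[OF True] mult_nonneg_nonneg[OF L0 zero_le_dist[of x y]] by linarith
      next
        case False
        have "2 * B = L * \<delta>" using \<delta> by (simp add: L_def)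
        also have "\<dots> \<le> L * dist x y" using False L0 by (intro mult_left_mono) auto
        finally have "2 * B \<le> L * dist x y" .
        moreover have "0 \<le> \<epsilon>" using unif[of x x] \<delta> by simp
        ultimately show ?thesis using B[of x] B[of y] by linarith
      qed
    qed
    then show "\<bar>h x - g x\<bar> \<le> \<epsilon>" using g_le[of x x] unif[of x x] \<delta> by simp
  qed
qed

definition BL_ball :: "('v::metric_space \<Rightarrow> real) set" where
  "BL_ball = {\<psi>. (\<forall>x. \<bar>\<psi> x\<bar> \<le> 1) \<and> (\<forall>x y. \<bar>\<psi> x - \<psi> y\<bar> \<le> dist x y)}"

lemma BL_ballD: "\<psi> \<in> BL_ball \<Longrightarrow> \<bar>\<psi> x\<bar> \<le> 1" "\<psi> \<in> BL_ball \<Longrightarrow> \<bar>\<psi> x - \<psi> y\<bar> \<le> dist x y"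
  by (auto simp: BL_ball_def)

lemma continuous_of_lipschitz:
  fixes \<psi> :: "'v::metric_space \<Rightarrow> real"
  assumes "\<And>x y. \<bar>\<psi> x - \<psi> y\<bar> \<le> L * dist x y"
  shows "continuous_on UNIV \<psi>"
proof -
  have "0 < \<bar>L\<bar> + 1" by simp
  have "\<bar>\<psi> x - \<psi> y\<bar> \<le> (\<bar>L\<bar> + 1) * dist x y" for x y
    using assms[of x y] mult_right_mono[of L "\<bar>L\<bar> + 1" "dist x y"] by force
  then have "(\<bar>L\<bar> + 1)-lipschitz_on UNIV \<psi>"
    by (intro lipschitz_onI) (auto simp: dist_real_def)
  then show ?thesis by (rule lipschitz_on_continuous_on)
qed

lemma BL_ball_measurable: "\<psi> \<in> BL_ball \<Longrightarrow> \<psi> \<in> borel_measurable borel"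
  by (intro borel_measurable_continuous_onI continuous_of_lipschitz[where L=1]) (auto dest: BL_ballD)

lemma DBL_eq: "DBL G G' = (SUP \<psi>\<in>BL_ball. \<bar>(\<integral>x. \<psi> x \<partial>G) - (\<integral>x. \<psi> x \<partial>G')\<bar>)"
  by (simp add: DBL_def BL_ball_def)

lemma abs_integral_le_subprob:
  fixes f :: "'a \<Rightarrow> real"
  assumes "subprob_space G" and "f \<in> borel_measurable G" and "\<And>x. \<bar>f x\<bar> \<le> B"
  shows "integrable G f" "\<bar>\<integral>x. f x \<partial>G\<bar> \<le> B"
proof -
  interpret subprob_space G by fact
  have B0: "0 \<le> B" using assms(3)[of undefined] by linarith
  show int: "integrable G f"
    by (rule integrable_const_bound[of _ B]) (use assms in auto)
  have "\<bar>\<integral>x. f x \<partial>G\<bar> \<le> (\<integral>x. \<bar>f x\<bar> \<partial>G)" using integral_norm_bound[of G f] by simp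
  also have "\<dots> \<le> (\<integral>x. B \<partial>G)" by (intro integral_mono integrable_abs int) (use assms in auto)
  also have "\<dots> = measure G (space G) * B" by simp
  also have "\<dots> \<le> 1 * B" by (intro mult_right_mono B0 subprob_measure_le_1)
  finally show "\<bar>\<integral>x. f x \<partial>G\<bar> \<le> B" by simp
qed

text \<open>In the application \<open>G\<close> is the posterior mean, which is the null measure
  when the evidence vanishes; hence subprobabilities. \<open>G'\<close> is the empirical measure,
  for which every set is measurable; hence an inclusion of sigma-algebras instead of
  equality.\<close>

locale two_subprobs =
  fixes G G' :: "'v::metric_space measure"
  assumes G: "subprob_space G" "sets borel \<subseteq> sets G" "space G = UNIV"
    and G': "subprob_space G'" "sets borel \<subseteq> sets G'" "space G' = UNIV"
begin

lemma borel_measurable: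
  assumes "f \<in> borel_measurable (borel :: 'v measure)"
  shows "(f :: 'v \<Rightarrow> real) \<in> borel_measurable G" "f \<in> borel_measurable G'"
  using assms G(2,3) G'(2,3) unfolding measurable_def by auto

text \<open>Bounds the set whose real supremum defines \<open>DBL\<close>; without such a bound
  \<open>SUP\<close> would not dominate its members.\<close>

lemma integral_diff_le_2:
  assumes "\<psi> \<in> BL_ball"
  shows "\<bar>(\<integral>x. \<psi> x \<partial>G) - (\<integral>x. \<psi> x \<partial>G')\<bar> \<le> 2"
  using abs_integral_le_subprob(2)[OF G(1) borel_measurable(1)[OF BL_ball_measurable], OF assms BL_ballD(1)[OF assms]]
    abs_integral_le_subprob(2)[OF G'(1) borel_measurable(2)[OF BL_ball_measurable], OF assms BL_ballD(1)[OF assms]]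
  by linarith

lemma DBL_upper:
  assumes "\<psi> \<in> BL_ball"
  shows "\<bar>(\<integral>x. \<psi> x \<partial>G) - (\<integral>x. \<psi> x \<partial>G')\<bar> \<le> DBL G G'"
  unfolding DBL_eq
  by (rule cSUP_upper[OF assms]) (auto intro!: bdd_aboveI[of _ 2] integral_diff_le_2)

lemma DBL_nonneg: "0 \<le> DBL G G'"
  using DBL_upper[of "\<lambda>_. 0"] by (simp add: BL_ball_def)

lemma DBL_le_2: "DBL G G' \<le> 2"
  unfolding DBL_eq by (rule cSUP_least) (auto intro: integral_diff_le_2 simp: BL_ball_def intro!: exI[of _ "\<lambda>_. 0"])

text \<open>A Lipschitz approximation \<open>g\<close> replaces \<open>h\<close> at the price
  \<open>\<epsilon>\<close> under each of the two measures, and \<open>g\<close> divided by a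
  constant is an admissible test function.\<close>

lemma integral_diff_le_DBL:
  fixes h :: "'v \<Rightarrow> real"
  assumes h: "h \<in> borel_measurable borel" and B: "\<And>x. \<bar>h x\<bar> \<le> B" and \<delta>: "0 < \<delta>"
    and unif: "\<And>x y. dist x y < \<delta> \<Longrightarrow> \<bar>h x - h y\<bar> \<le> \<epsilon>"
  shows "\<bar>(\<integral>x. h x \<partial>G) - (\<integral>x. h x \<partial>G')\<bar> \<le> 2 * \<epsilon> + (1 + B + 2 * B / \<delta>) * DBL G G'"
proof -
  obtain g where g: "\<And>x. \<bar>g x\<bar> \<le> B" "\<And>x y. \<bar>g x - g y\<bar> \<le> 2 * B / \<delta> * dist x y"
    "\<And>x. \<bar>h x - g x\<bar> \<le> \<epsilon>" using lipschitz_approximation[of h B \<delta> \<epsilon>, OF B \<delta> unif] by blast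
  have B0: "0 \<le> B" using B[of undefined] by linarith
  \<comment> \<open>One factor above both the sup norm and the Lipschitz constant of
    \<open>g\<close>; the summand 1 keeps it positive when \<open>B\<close> is 0.\<close>
  define K where "K = 1 + B + 2 * B / \<delta>"
  have K: "0 < K" "B \<le> K" "2 * B / \<delta> \<le> K" using B0 \<delta> by (auto simp: K_def add_pos_nonneg)
  have gm: "g \<in> borel_measurable borel"
    by (intro borel_measurable_continuous_onI continuous_of_lipschitz[OF g(2)])
  have "(\<lambda>x. g x / K) \<in> BL_ball"
    unfolding BL_ball_def
  proof (intro CollectI conjI allI)
    fix x y
    show "\<bar>g x / K\<bar> \<le> 1" using g(1)[of x] K by simp
    have "\<bar>g x - g y\<bar> \<le> K * dist x y"
      using g(2)[of x y] mult_right_mono[OF K(3) zero_le_dist[of x y]] by linarith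
    then show "\<bar>g x / K - g y / K\<bar> \<le> dist x y"
      using K by (simp add: diff_divide_distrib[symmetric] abs_div field_simps)
  qed
  from DBL_upper[OF this] have "\<bar>(\<integral>x. g x \<partial>G) - (\<integral>x. g x \<partial>G')\<bar> / K \<le> DBL G G'"
    using K by (simp add: diff_divide_distrib[symmetric] abs_div)
  then have gd: "\<bar>(\<integral>x. g x \<partial>G) - (\<integral>x. g x \<partial>G')\<bar> \<le> K * DBL G G'"
    using K by (simp add: field_simps)
  have close: "\<bar>(\<integral>x. h x \<partial>N) - (\<integral>x. g x \<partial>N)\<bar> \<le> \<epsilon>"
    if N: "subprob_space N" "h \<in> borel_measurable N" "g \<in> borel_measurable N" for N
  proof -
    have "(\<integral>x. h x \<partial>N) - (\<integral>x. g x \<partial>N) = (\<integral>x. h x - g x \<partial>N)"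
      using abs_integral_le_subprob(1)[OF N(1,2) B] abs_integral_le_subprob(1)[OF N(1,3) g(1)] by simp
    also have "\<bar>\<dots>\<bar> \<le> \<epsilon>"
      by (rule abs_integral_le_subprob(2)[OF N(1)]) (use N g(3) in auto)
    finally show ?thesis .
  qed
  show ?thesis
    using close[OF G(1)] close[OF G'(1)] borel_measurable[OF h] borel_measurable[OF gm] gd
    unfolding K_def by linarith
qed

end

section \<open>Finite nets, countable dense sets and measurability of the distance\<close>

lemma totally_bounded_UNIV:
  assumes "compact (UNIV :: 'v::metric_space set)" and "0 < \<epsilon>"
  obtains K :: "'v::metric_space set" where "finite K" "\<And>x. \<exists>k\<in>K. dist k x < \<epsilon>"
proof -
  have "seq_compact (UNIV :: 'v set)" using assms(1) by (simp add: compact_eq_seq_compact_metric)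
  from seq_compact_imp_totally_bounded[OF this] \<open>0 < \<epsilon>\<close>
  obtain K :: "'v set" where "finite K" "UNIV \<subseteq> (\<Union>x\<in>K. ball x \<epsilon>)" by metis
  then show thesis by (intro that[of K]) (auto simp: subset_eq)
qed

text \<open>The union of finite nets of mesh \<open>1 / Suc n\<close>. It makes the quantifier over
  nuisance parameters countable in the proof of joint measurability below.\<close>

lemma countable_dense_UNIV:
  assumes "compact (UNIV :: 'v::metric_space set)"
  obtains D :: "'v::metric_space set" where "countable D" "\<And>x \<epsilon>. 0 < \<epsilon> \<Longrightarrow> \<exists>d\<in>D. dist d x < \<epsilon>"
proof -
  have "\<exists>K :: 'v set. finite K \<and> (\<forall>x. \<exists>k\<in>K. dist k x < 1 / Suc n)" for n
    using totally_bounded_UNIV[OF assms, of "1 / Suc n"] by (metis of_nat_0_less_iff zero_less_Suc zero_less_divide_1_iff)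
  then obtain K :: "nat \<Rightarrow> 'v set" where K: "\<And>n. finite (K n)" "\<And>n x. \<exists>k\<in>K n. dist k x < 1 / Suc n"
    by metis
  show thesis
  proof (rule that[of "\<Union>n. K n"])
    show "countable (\<Union>n. K n)" using K(1) by (simp add: countable_finite)
    fix x :: 'v and \<epsilon> :: real assume "0 < \<epsilon>"
    then obtain n where "1 / Suc n < \<epsilon>" using reals_Archimedean[of \<epsilon>] by (auto simp: inverse_eq_divide)
    then show "\<exists>d\<in>\<Union>n. K n. dist d x < \<epsilon>" using K(2)[of n x] less_trans by blast
  qed
qed

text \<open>An Arzela-Ascoli argument by rounding. Of the \<open>3 * \<epsilon>\<close>, one part is
  the rounding error at a point of \<open>K\<close>, and the other two are the Lipschitz errors of
  the two functions in moving from there to \<open>x\<close>.\<close>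

lemma BL_ball_finite_net:
  assumes "compact (UNIV :: 'v::metric_space set)" and "0 < \<epsilon>"
  obtains N :: "('v::metric_space \<Rightarrow> real) set" where "finite N" "N \<subseteq> BL_ball"
    "\<And>\<psi>. \<psi> \<in> BL_ball \<Longrightarrow> \<exists>\<phi>\<in>N. \<forall>x. \<bar>\<psi> x - \<phi> x\<bar> \<le> 3 * \<epsilon>"
proof -
  obtain K :: "'v set" where K: "finite K" "\<And>x. \<exists>k\<in>K. dist k x < \<epsilon>"
    using totally_bounded_UNIV[OF assms] by metis
  \<comment> \<open>Two members of the ball with the same rounded values on \<open>K\<close> are uniformly close,
      and there are finitely many patterns of rounded values.\<close>
  define code where "code \<psi> = (\<lambda>k\<in>K. \<lfloor>\<psi> k / \<epsilon>\<rfloor>)" for \<psi> :: "'v \<Rightarrow> real"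
  have "code ` BL_ball \<subseteq> (\<Pi>\<^sub>E k\<in>K. {\<lfloor>- 1 / \<epsilon>\<rfloor>..\<lfloor>1 / \<epsilon>\<rfloor>})"
  proof (clarsimp simp: code_def PiE_iff)
    fix \<psi> :: "'v \<Rightarrow> real" and k assume "\<psi> \<in> BL_ball"
    then have "- 1 \<le> \<psi> k" "\<psi> k \<le> 1" using BL_ballD(1)[of \<psi> k] by auto
    then show "\<lfloor>- (1 / \<epsilon>)\<rfloor> \<le> \<lfloor>\<psi> k / \<epsilon>\<rfloor> \<and> \<lfloor>\<psi> k / \<epsilon>\<rfloor> \<le> \<lfloor>1 / \<epsilon>\<rfloor>"
      using \<open>0 < \<epsilon>\<close> divide_right_mono[of "-1" "\<psi> k" \<epsilon>]
      by (intro conjI floor_mono divide_right_mono) auto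
  qed
  then have fin: "finite (code ` BL_ball)"
    by (rule finite_subset) (intro finite_PiE K(1) finite_atLeastAtMost_int)
  define rep where "rep = inv_into BL_ball code"
  show thesis
  proof (rule that[of "rep ` code ` BL_ball"])
    show "finite (rep ` code ` BL_ball)" using fin by simp
    show "rep ` code ` BL_ball \<subseteq> BL_ball" by (auto simp: rep_def intro: inv_into_into)
    fix \<psi> :: "'v \<Rightarrow> real" assume \<psi>: "\<psi> \<in> BL_ball"
    define \<phi> where "\<phi> = rep (code \<psi>)"
    have \<phi>: "\<phi> \<in> BL_ball" "code \<phi> = code \<psi>"
      unfolding \<phi>_def rep_def using \<psi> by (simp_all add: inv_into_into f_inv_into_f)
    have "\<bar>\<psi> x - \<phi> x\<bar> \<le> 3 * \<epsilon>" for x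
    proof -
      obtain k where k: "k \<in> K" "dist k x < \<epsilon>" using K(2) by blast
      have "\<lfloor>\<psi> k / \<epsilon>\<rfloor> = \<lfloor>\<phi> k / \<epsilon>\<rfloor>" using fun_cong[OF \<phi>(2), of k] k(1) by (simp add: code_def)
      then have "\<bar>\<psi> k / \<epsilon> - \<phi> k / \<epsilon>\<bar> < 1" by linarith
      then have "\<bar>\<psi> k - \<phi> k\<bar> < \<epsilon>"
        using \<open>0 < \<epsilon>\<close> by (simp add: diff_divide_distrib[symmetric] abs_div)
      moreover have "\<bar>\<psi> k - \<psi> x\<bar> < \<epsilon>" "\<bar>\<phi> k - \<phi> x\<bar> < \<epsilon>"
        using BL_ballD(2)[OF \<psi>, of k x] BL_ballD(2)[OF \<phi>(1), of k x] k(2) by auto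
      ultimately show ?thesis by linarith
    qed
    then show "\<exists>\<phi>\<in>rep ` code ` BL_ball. \<forall>x. \<bar>\<psi> x - \<phi> x\<bar> \<le> 3 * \<epsilon>"
      using \<psi> by (auto simp: \<phi>_def)
  qed
qed

text \<open>Measurability matters: the Bochner integral of a non-measurable function is 0, so without it
  a bound on \<open>post_err\<close> would carry no information. The supremum reduces to a countable one because
  the ball of test functions is totally bounded for the uniform norm.\<close>
lemma borel_measurable_DBL:
  fixes G :: "'a \<Rightarrow> 'v::metric_space measure"
  assumes cpt: "compact (UNIV :: 'v set)"
    and G: "\<And>x. x \<in> space M \<Longrightarrow> two_subprobs (G x) G'"
    and meas: "\<And>\<psi>. \<psi> \<in> BL_ball \<Longrightarrow> (\<lambda>x. \<integral>y. \<psi> y \<partial>G x) \<in> borel_measurable M"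
  shows "(\<lambda>x. DBL (G x) G') \<in> borel_measurable M"
proof -
  have "\<exists>N :: ('v \<Rightarrow> real) set. finite N \<and> N \<subseteq> BL_ball \<and>
      (\<forall>\<psi>\<in>BL_ball. \<exists>\<phi>\<in>N. \<forall>x. \<bar>\<psi> x - \<phi> x\<bar> \<le> 3 * (1 / Suc n))" for n
    using BL_ball_finite_net[OF cpt, of "1 / Suc n"]
    by (metis of_nat_0_less_iff zero_less_Suc zero_less_divide_1_iff)
  then obtain N :: "nat \<Rightarrow> ('v \<Rightarrow> real) set" where N: "\<And>n. finite (N n)" "\<And>n. N n \<subseteq> BL_ball"
    "\<And>n \<psi>. \<psi> \<in> BL_ball \<Longrightarrow> \<exists>\<phi>\<in>N n. \<forall>x. \<bar>\<psi> x - \<phi> x\<bar> \<le> 3 * (1 / Suc n)" by metis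
  define D where "D = (\<Union>n. N n)"
  have D: "countable D" "D \<subseteq> BL_ball" using N(1,2) by (auto simp: D_def countable_finite)
  have zero: "(\<lambda>_. 0) \<in> BL_ball" by (simp add: BL_ball_def)
  define d where "d x \<psi> = \<bar>(\<integral>y. \<psi> y \<partial>G x) - (\<integral>y. \<psi> y \<partial>G')\<bar>" for x and \<psi> :: "'v \<Rightarrow> real"
  have bdd: "bdd_above (d x ` A)" if "x \<in> space M" "A \<subseteq> BL_ball" for x A
    unfolding d_def using two_subprobs.integral_diff_le_2[OF G[OF that(1)]] that(2)
    by (intro bdd_aboveI[of _ 2]) auto
  have eq: "DBL (G x) G' = (SUP \<psi>\<in>D. d x \<psi>)" if x: "x \<in> space M" for x
  proof (rule antisym)
    interpret two_subprobs "G x" G' by (rule G[OF x])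
    show "(SUP \<psi>\<in>D. d x \<psi>) \<le> DBL (G x) G'"
      unfolding DBL_eq d_def[symmetric]
      using N(3)[OF zero] by (intro cSUP_subset_mono bdd x D order_refl) (force simp: D_def)+
    show "DBL (G x) G' \<le> (SUP \<psi>\<in>D. d x \<psi>)"
      unfolding DBL_eq d_def[symmetric]
    proof (rule cSUP_least)
      show "BL_ball \<noteq> ({} :: ('v \<Rightarrow> real) set)" using zero by auto
      fix \<psi> :: "'v \<Rightarrow> real" assume \<psi>: "\<psi> \<in> BL_ball"
      show "d x \<psi> \<le> (SUP \<psi>\<in>D. d x \<psi>)"
      proof (rule field_le_epsilon)
        fix e :: real assume "0 < e"
        \<comment> \<open>The net is accurate to three times \<open>1 / Suc n\<close>, and the
          replacement of \<open>\<psi>\<close> by \<open>\<phi>\<close> is paid for under both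
          measures.\<close>
        then obtain n where n: "1 / Suc n < e / 6"
          using reals_Archimedean[of "e / 6"] by (auto simp: inverse_eq_divide)
        obtain \<phi> where \<phi>: "\<phi> \<in> N n" "\<And>x. \<bar>\<psi> x - \<phi> x\<bar> \<le> 3 * (1 / Suc n)" using N(3)[OF \<psi>] by blast
        have \<phi>': "\<phi> \<in> BL_ball" using N(2) \<phi>(1) by auto
        have close: "\<bar>(\<integral>y. \<psi> y \<partial>L) - (\<integral>y. \<phi> y \<partial>L)\<bar> \<le> e / 2"
          if L: "subprob_space L" "\<psi> \<in> borel_measurable L" "\<phi> \<in> borel_measurable L" for L
        proof -
          have "(\<integral>y. \<psi> y \<partial>L) - (\<integral>y. \<phi> y \<partial>L) = (\<integral>y. \<psi> y - \<phi> y \<partial>L)"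
            using abs_integral_le_subprob(1)[OF L(1,2) BL_ballD(1)[OF \<psi>]]
              abs_integral_le_subprob(1)[OF L(1,3) BL_ballD(1)[OF \<phi>']] by simp
          also have "\<bar>\<dots>\<bar> \<le> 3 * (1 / Suc n)"
            by (rule abs_integral_le_subprob(2)[OF L(1)]) (use L \<phi>(2) in auto)
          finally show ?thesis using n by simp
        qed
        have "d x \<psi> \<le> d x \<phi> + e"
          using close[OF G(1)] close[OF G'(1)] borel_measurable[OF BL_ball_measurable[OF \<psi>]]
            borel_measurable[OF BL_ball_measurable[OF \<phi>']] unfolding d_def by linarith
        also have "d x \<phi> \<le> (SUP \<psi>\<in>D. d x \<psi>)"
          using \<phi>(1) D by (intro cSUP_upper bdd x) (auto simp: D_def)
        finally show "d x \<psi> \<le> (SUP \<psi>\<in>D. d x \<psi>) + e" by simp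
      qed
    qed
  qed
  have "(\<lambda>x. SUP \<psi>\<in>D. d x \<psi>) \<in> borel_measurable M"
  proof (rule borel_measurable_cSUP)
    fix \<psi> assume "\<psi> \<in> D"
    then have [measurable]: "(\<lambda>x. \<integral>y. \<psi> y \<partial>G x) \<in> borel_measurable M" using meas D by auto
    show "(\<lambda>x. d x \<psi>) \<in> borel_measurable M" unfolding d_def by measurable
  qed (use D bdd in auto)
  then show ?thesis using eq by (subst measurable_cong) auto
qed

subsection \<open>Measurability and product measures\<close>

text \<open>By continuity in the second argument, \<open>a \<le> f u v\<close> can be tested on a
  countable dense set: for every \<open>n\<close> some \<open>d\<close> closer than
  \<open>1 / Suc n\<close> to \<open>v\<close> has a value above \<open>a - 1 / Suc n\<close>. This
  writes the level set through countably many measurable conditions.\<close>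

lemma borel_measurable_caratheodory:
  fixes f :: "'a \<Rightarrow> 'v::metric_space \<Rightarrow> real"
  assumes cpt: "compact (UNIV :: 'v set)"
    and [measurable]: "\<And>v. (\<lambda>u. f u v) \<in> borel_measurable M"
    and cont: "\<And>u. u \<in> space M \<Longrightarrow> continuous_on UNIV (f u)"
  shows "(\<lambda>(u, v). f u v) \<in> borel_measurable (M \<Otimes>\<^sub>M borel)"
proof -
  obtain D :: "'v set" where D: "countable D" "\<And>x \<epsilon>. 0 < \<epsilon> \<Longrightarrow> \<exists>d\<in>D. dist d x < \<epsilon>"
    using countable_dense_UNIV[OF cpt] by metis
  have eq: "a \<le> f u v \<longleftrightarrow> (\<forall>n. \<exists>d\<in>D. dist d v < 1 / Suc n \<and> a - 1 / Suc n < f u d)"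
    (is "_ \<longleftrightarrow> ?R") if u: "u \<in> space M" for a u v
  proof
    assume a: "a \<le> f u v"
    show ?R
    proof
      fix n
      define e where "e = 1 / Suc n"
      have e: "0 < e" by (simp add: e_def)
      obtain \<delta> where \<delta>: "0 < \<delta>" "\<And>w. dist w v < \<delta> \<Longrightarrow> dist (f u w) (f u v) < e"
        using cont[OF u] e unfolding continuous_on_iff by blast
      obtain d where "d \<in> D" "dist d v < min \<delta> e" using D(2)[of "min \<delta> e" v] \<delta>(1) e by auto
      then show "\<exists>d\<in>D. dist d v < 1 / Suc n \<and> a - 1 / Suc n < f u d"
        using a \<delta>(2)[of d] by (intro bexI[of _ d]) (auto simp: dist_real_def e_def)
    qed
  next
    assume R: ?R
    show "a \<le> f u v"
    proof (rule field_le_epsilon)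
      fix e :: real assume e: "0 < e"
      obtain \<delta> where \<delta>: "0 < \<delta>" "\<And>w. dist w v < \<delta> \<Longrightarrow> dist (f u w) (f u v) < e / 2"
        using cont[OF u] half_gt_zero[OF e] unfolding continuous_on_iff by blast
      obtain n where n: "1 / Suc n < min \<delta> (e / 2)"
        using reals_Archimedean[of "min \<delta> (e / 2)"] \<delta>(1) e by (auto simp: inverse_eq_divide)
      obtain d where d: "dist d v < 1 / Suc n" "a - 1 / Suc n < f u d" using R by blast
      then have "\<bar>f u d - f u v\<bar> < e / 2" using \<delta>(2)[of d] n by (auto simp: dist_real_def)
      then show "a \<le> f u v + e" using d(2) n by linarith
    qed
  qed
  show ?thesis
  proof (unfold borel_measurable_iff_ge, rule allI)
    fix a :: real
    have [measurable]: "Measurable.pred (M \<Otimes>\<^sub>M borel) (\<lambda>w. dist d (snd w) < e)" for d :: 'v and e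
    proof -
      have "Measurable.pred borel (\<lambda>v. dist d v < e)"
        using borel_open[OF open_ball[of d e]] by (simp add: pred_def ball_def)
      then show ?thesis by (rule measurable_compose[OF measurable_snd])
    qed
    have "{w \<in> space (M \<Otimes>\<^sub>M borel). a \<le> (case w of (u, v) \<Rightarrow> f u v)} =
      {w \<in> space (M \<Otimes>\<^sub>M borel). \<forall>n. \<exists>d\<in>D. dist d (snd w) < 1 / Suc n \<and> a - 1 / Suc n < f (fst w) d}"
      using eq by (auto simp: space_pair_measure)
    also have "\<dots> \<in> sets (M \<Otimes>\<^sub>M borel)" using D(1) by measurable
    finally show "{w \<in> space (M \<Otimes>\<^sub>M borel). a \<le> (case w of (u, v) \<Rightarrow> f u v)} \<in> sets (M \<Otimes>\<^sub>M borel)" .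
  qed
qed

lemma sum_measure_le:
  assumes M: "\<And>i. i \<in> I \<Longrightarrow> finite_measure (M i)" and "0 \<le> b"
    and le: "(\<Sum>i\<in>I. emeasure (M i) (A i)) \<le> ennreal b"
  shows "(\<Sum>i\<in>I. measure (M i) (A i)) \<le> b"
proof -
  have "(\<Sum>i\<in>I. emeasure (M i) (A i)) = (\<Sum>i\<in>I. ennreal (measure (M i) (A i)))"
    by (intro sum.cong refl finite_measure.emeasure_eq_measure M)
  also have "\<dots> = ennreal (\<Sum>i\<in>I. measure (M i) (A i))" by (rule sum_ennreal) simp
  finally show ?thesis using le \<open>0 \<le> b\<close> by simp
qed

text \<open>Product measures are determined by boxes, and the preimage of a box is a box over
  \<open>J\<close> extended by full coordinates. With \<open>f\<close> as \<open>snd\<close>, this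
  identifies the law of the nuisance data of the other units under the full data law.\<close>

lemma distr_PiM_marginal:
  assumes I: "finite I" "J \<subseteq> I" and M: "\<And>i. prob_space (M i)" and f: "\<And>i. f \<in> M i \<rightarrow>\<^sub>M N i"
  shows "distr (PiM I M) (PiM J N) (\<lambda>\<omega>. \<lambda>j\<in>J. f (\<omega> j)) = PiM J (\<lambda>j. distr (M j) (N j) f)"
proof -
  have J: "finite J" using I by (rule finite_subset[rotated])
  have N: "prob_space (distr (M i) (N i) f)" for i
    by (rule prob_space.prob_space_distr[OF M f])
  interpret P: product_prob_space M I by (intro product_prob_spaceI M)
  interpret Q: product_prob_space "\<lambda>i. distr (M i) (N i) f" J by (intro product_prob_spaceI N)
  have [measurable]: "(\<lambda>\<omega>. \<lambda>j\<in>J. f (\<omega> j)) \<in> PiM I M \<rightarrow>\<^sub>M PiM J N"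
    using I by (intro measurable_restrict measurable_compose[OF _ f] measurable_component_singleton) auto
  show ?thesis
  proof (rule Q.PiM_eqI[OF J])
    show "sets (distr (PiM I M) (PiM J N) (\<lambda>\<omega>. \<lambda>j\<in>J. f (\<omega> j))) = sets (PiM J (\<lambda>j. distr (M j) (N j) f))"
      by (simp cong: sets_PiM_cong)
    fix A assume A: "\<And>j. j \<in> J \<Longrightarrow> A j \<in> sets (distr (M j) (N j) f)"
    have 1: "(\<lambda>\<omega>. \<lambda>j\<in>J. f (\<omega> j)) -` Pi\<^sub>E J A \<inter> space (PiM I M) =
        prod_emb I M J (\<Pi>\<^sub>E j\<in>J. f -` A j \<inter> space (M j))"
      using I by (auto simp: prod_emb_def space_PiM PiE_iff extensional_def subset_eq)
    have "emeasure (distr (PiM I M) (PiM J N) (\<lambda>\<omega>. \<lambda>j\<in>J. f (\<omega> j))) (Pi\<^sub>E J A) =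
        emeasure (PiM I M) (prod_emb I M J (\<Pi>\<^sub>E j\<in>J. f -` A j \<inter> space (M j)))"
      using A J by (subst emeasure_distr) (auto simp: 1 intro!: sets_PiM_I_finite)
    also have "\<dots> = (\<Prod>j\<in>J. emeasure (M j) (f -` A j \<inter> space (M j)))"
      using A I J f by (intro P.emeasure_PiM_emb) auto
    also have "\<dots> = (\<Prod>j\<in>J. emeasure (distr (M j) (N j) f) (A j))"
      using A f by (intro prod.cong refl emeasure_distr[symmetric]) auto
    finally show "emeasure (distr (PiM I M) (PiM J N) (\<lambda>\<omega>. \<lambda>j\<in>J. f (\<omega> j))) (Pi\<^sub>E J A) =
      (\<Prod>j\<in>J. emeasure (distr (M j) (N j) f) (A j))" .
  qed
qed

subsection \<open>The hierarchical model\<close>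

locale hierarchical_model =
  fixes lam :: "'u::metric_space measure"
    and p :: "'u \<Rightarrow> 'v::metric_space \<Rightarrow> real"
    and F :: "'th \<Rightarrow> 'v \<Rightarrow> 'u \<Rightarrow> real measure"
    and \<theta>0 :: 'th
    and Prior :: "'v measure measure"
  assumes kernel: "\<And>\<theta> \<nu>. (\<lambda>u. F \<theta> \<nu> u) \<in> borel \<rightarrow>\<^sub>M prob_algebra borel"
    and lam_sets: "sets lam = sets (borel :: 'u measure)"
    and p_nonneg: "\<And>u \<nu>. 0 \<le> p u \<nu>"
    and p_meas: "\<And>\<nu>. (\<lambda>u. p u \<nu>) \<in> borel_measurable borel"
    and Q_prob: "\<And>\<nu>. prob_space (Qlaw lam p \<nu>)"
    and Pi_sets: "sets Prior = sets (prob_algebra (borel :: 'v measure))"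
    and Pi_prob: "prob_space Prior"
    and A2: "compact (UNIV :: 'v set)"
    and A3: "\<forall>\<epsilon>>0. \<exists>\<delta>>0. \<forall>t u \<nu> \<nu>'. dist \<nu> \<nu>' < \<delta> \<longrightarrow>
                 \<bar>Por F \<theta>0 t u \<nu> - Por F \<theta>0 t u \<nu>'\<bar> < \<epsilon>"
    and A4_fin: "\<And>C. compact C \<Longrightarrow> emeasure lam C < \<infinity>"
    and A4_bdd: "\<And>C. compact C \<Longrightarrow> \<exists>B. \<forall>u\<in>C. \<forall>\<nu>. \<bar>p u \<nu>\<bar> \<le> B"
    and A4_eqc: "\<And>C. compact C \<Longrightarrow> \<forall>\<epsilon>>0. \<exists>\<delta>>0. \<forall>u\<in>C. \<forall>\<nu> \<nu>'.
                   dist \<nu> \<nu>' < \<delta> \<longrightarrow> \<bar>p u \<nu> - p u \<nu>'\<bar> < \<epsilon>"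
begin

lemma sets_Qlaw [simp, measurable_cong]: "sets (Qlaw lam p \<nu>) = sets borel"
  and space_Qlaw [simp]: "space (Qlaw lam p \<nu>) = UNIV"
  using lam_sets sets_eq_imp_space_eq[OF lam_sets] by (simp_all add: Qlaw_def)

lemma F_prob: "prob_space (F \<theta> \<nu> u)"
  and sets_F: "sets (F \<theta> \<nu> u) = sets borel"
  and space_F: "space (F \<theta> \<nu> u) = UNIV"
  using measurable_space[OF kernel[of \<theta> \<nu>], of u] sets_eq_imp_space_eq[of "F \<theta> \<nu> u" borel]
  by (auto simp: space_prob_algebra)

text \<open>Singletons are compact, so assumptions stated on compact sets also give boundedness, and
  below continuity, of \<open>p u\<close> for each single \<open>u\<close>.\<close>

lemma p_le: obtains B where "\<And>\<nu>. p u \<nu> \<le> B"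
  using A4_bdd[of "{u}"] by (metis abs_le_D1 compact_sing singletonI)

lemma continuous_p: "continuous_on UNIV (p u)"
  unfolding continuous_on_iff
proof (intro ballI allI impI)
  fix x :: 'v and e :: real assume "0 < e"
  then obtain \<delta> where "\<delta> > 0" "\<forall>\<nu> \<nu>'. dist \<nu> \<nu>' < \<delta> \<longrightarrow> \<bar>p u \<nu> - p u \<nu>'\<bar> < e"
    using A4_eqc[of "{u}"] by auto
  then show "\<exists>d>0. \<forall>x'\<in>UNIV. dist x' x < d \<longrightarrow> dist (p u x') (p u x) < e"
    by (auto simp: dist_real_def)
qed

lemma Por_bounds: "0 \<le> Por F \<theta> t u \<nu>" "Por F \<theta> t u \<nu> \<le> 1"
  using prob_space.prob_le_1[OF F_prob] by (auto simp: Por_def)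

lemma continuous_Por: "continuous_on UNIV (Por F \<theta>0 t u)"
  unfolding continuous_on_iff
proof (intro ballI allI impI)
  fix x :: 'v and e :: real assume "0 < e"
  then obtain \<delta> where "\<delta> > 0" "\<forall>t u \<nu> \<nu>'. dist \<nu> \<nu>' < \<delta> \<longrightarrow> \<bar>Por F \<theta>0 t u \<nu> - Por F \<theta>0 t u \<nu>'\<bar> < e"
    using A3 by blast
  then show "\<exists>d>0. \<forall>x'\<in>UNIV. dist x' x < d \<longrightarrow> dist (Por F \<theta>0 t u x') (Por F \<theta>0 t u x) < e"
    by (auto simp: dist_real_def)
qed

lemma borel_measurable_Por: "(\<lambda>z. Por F \<theta> (fst z) (snd z) \<nu>) \<in> borel_measurable (borel \<Otimes>\<^sub>M borel)"
  unfolding Por_def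
proof (rule measure_measurable_subprob_algebra2)
  show "(SIGMA z:space (borel \<Otimes>\<^sub>M borel). {s. \<bar>fst z\<bar> \<le> \<bar>s\<bar>})
      \<in> sets ((borel \<Otimes>\<^sub>M (borel :: 'u measure)) \<Otimes>\<^sub>M (borel :: real measure))"
  proof -
    have "(SIGMA z:space (borel \<Otimes>\<^sub>M borel). {s. \<bar>fst z\<bar> \<le> \<bar>s\<bar>}) =
      {w \<in> space ((borel \<Otimes>\<^sub>M (borel :: 'u measure)) \<Otimes>\<^sub>M (borel :: real measure)). \<bar>fst (fst w)\<bar> \<le> \<bar>snd w\<bar>}"
      by (auto simp: space_pair_measure)
    then show ?thesis by simp
  qed
  show "(\<lambda>z. F \<theta> \<nu> (snd z)) \<in> borel \<Otimes>\<^sub>M borel \<rightarrow>\<^sub>M subprob_algebra borel"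
    by (rule measurable_compose[OF measurable_snd measurable_prob_algebraD[OF kernel]])
qed

lemma borel_measurable_p: "(\<lambda>(u, \<nu>). p u \<nu>) \<in> borel_measurable (borel \<Otimes>\<^sub>M borel)"
  by (rule borel_measurable_caratheodory[OF A2 p_meas continuous_p])

lemma borel_measurable_p_nuisance: "p u \<in> borel_measurable borel"
  by (rule borel_measurable_continuous_onI[OF continuous_p])

lemma data_kernel:
  "(\<lambda>u. distr (F \<theta> \<nu> u) (borel \<Otimes>\<^sub>M borel) (\<lambda>t. (t, u))) \<in> borel \<rightarrow>\<^sub>M prob_algebra (borel \<Otimes>\<^sub>M borel)"
  by (rule measurable_distr_prob_space2[OF kernel]) simp

lemma data_kernel_Qlaw:
  "(\<lambda>u. distr (F \<theta> \<nu> u) (borel \<Otimes>\<^sub>M borel) (\<lambda>t. (t, u))) \<in> Qlaw lam p \<nu> \<rightarrow>\<^sub>M prob_algebra (borel \<Otimes>\<^sub>M borel)"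
  using data_kernel by (subst measurable_cong_sets[OF sets_Qlaw refl])

lemma sets_data_law [simp, measurable_cong]:
  "sets (data_law lam p F \<theta> \<nu>) = sets (borel \<Otimes>\<^sub>M borel)"
  unfolding data_law_def by (rule sets_bind) simp_all

lemma space_data_law [simp]: "space (data_law lam p F \<theta> \<nu>) = UNIV"
  using sets_eq_imp_space_eq[OF sets_data_law] by (simp add: space_pair_measure)

lemma prob_space_data_law: "prob_space (data_law lam p F \<theta> \<nu>)"
  unfolding data_law_def
proof (rule prob_space.prob_space_bind[OF Q_prob])
  show "AE u in Qlaw lam p \<nu>. prob_space (distr (F \<theta> \<nu> u) (borel \<Otimes>\<^sub>M borel) (\<lambda>t. (t, u)))"
    using measurable_space[OF data_kernel] by (simp add: space_prob_algebra)
qed (rule measurable_prob_algebraD[OF data_kernel_Qlaw])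

lemma emeasure_data_law:
  assumes A: "A \<in> sets (borel \<Otimes>\<^sub>M borel)"
  shows "emeasure (data_law lam p F \<theta> \<nu>) A = (\<integral>\<^sup>+u. emeasure (F \<theta> \<nu> u) {t. (t, u) \<in> A} \<partial>Qlaw lam p \<nu>)"
  unfolding data_law_def
proof (subst emeasure_bind[OF _ measurable_prob_algebraD[OF data_kernel_Qlaw] A])
  have "emeasure (distr (F \<theta> \<nu> u) (borel \<Otimes>\<^sub>M borel) (\<lambda>t. (t, u))) A = emeasure (F \<theta> \<nu> u) {t. (t, u) \<in> A}" for u
  proof -
    have [measurable_cong]: "sets (F \<theta> \<nu> u) = sets borel" by (rule sets_F)
    show ?thesis by (subst emeasure_distr[OF _ A]) (auto simp: space_F vimage_def)
  qed
  then show "(\<integral>\<^sup>+ u. emeasure (distr (F \<theta> \<nu> u) (borel \<Otimes>\<^sub>M borel) (\<lambda>t. (t, u))) A \<partial>Qlaw lam p \<nu>) =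
    (\<integral>\<^sup>+u. emeasure (F \<theta> \<nu> u) {t. (t, u) \<in> A} \<partial>Qlaw lam p \<nu>)" by simp
qed simp

lemma distr_data_law_snd: "distr (data_law lam p F \<theta> \<nu>) borel snd = Qlaw lam p \<nu>"
proof (rule measure_eqI)
  fix A assume "A \<in> sets (distr (data_law lam p F \<theta> \<nu>) borel snd)"
  then have A [measurable]: "A \<in> sets borel" by simp
  have [measurable]: "snd \<in> data_law lam p F \<theta> \<nu> \<rightarrow>\<^sub>M borel"
    by (subst measurable_cong_sets[OF sets_data_law refl]) simp
  have A': "snd -` A \<in> sets (borel \<Otimes>\<^sub>M borel)"
    using measurable_sets[OF measurable_snd A, of borel] by (simp add: space_pair_measure)
  have "emeasure (distr (data_law lam p F \<theta> \<nu>) borel snd) A = emeasure (data_law lam p F \<theta> \<nu>) (snd -` A)"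
    by (subst emeasure_distr) auto
  also have "\<dots> = (\<integral>\<^sup>+u. indicator A u \<partial>Qlaw lam p \<nu>)"
    unfolding emeasure_data_law[OF A']
  proof (rule nn_integral_cong)
    fix u show "emeasure (F \<theta> \<nu> u) {t. (t, u) \<in> snd -` A} = indicator A u"
      using prob_space.emeasure_space_1[OF F_prob[of \<theta> \<nu> u]] by (auto simp: space_F indicator_def)
  qed
  also have "\<dots> = emeasure (Qlaw lam p \<nu>) A" by simp
  finally show "emeasure (distr (data_law lam p F \<theta> \<nu>) borel snd) A = emeasure (Qlaw lam p \<nu>) A" .
qed simp

lemma measure_data_law_snd:
  assumes "A \<in> sets borel"
  shows "measure (data_law lam p F \<theta> \<nu>) {z. snd z \<in> A} = measure (Qlaw lam p \<nu>) A"
proof -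
  have "snd \<in> data_law lam p F \<theta> \<nu> \<rightarrow>\<^sub>M borel"
    by (subst measurable_cong_sets[OF sets_data_law refl]) simp
  then show ?thesis
    unfolding distr_data_law_snd[of \<theta> \<nu>, symmetric] using assms
    by (subst measure_distr) (auto simp: vimage_def)
qed

text \<open>The p-value of an oracle whose prior for the nuisance parameter is the empirical measure of all
  \<open>n\<close> true nuisance parameters; it is exactly super-uniform on average over the units.\<close>
definition pstar :: "(nat \<Rightarrow> 'v) \<Rightarrow> nat \<Rightarrow> real \<Rightarrow> 'u \<Rightarrow> real" where
  "pstar \<nu> n t u = (\<Sum>j<n. Por F \<theta>0 t u (\<nu> j) * p u (\<nu> j)) / (\<Sum>j<n. p u (\<nu> j))"

lemma borel_measurable_pstar: "(\<lambda>z. pstar \<nu> n (fst z) (snd z)) \<in> borel_measurable (borel \<Otimes>\<^sub>M borel)"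
proof -
  note [measurable] = borel_measurable_Por p_meas
  show ?thesis unfolding pstar_def by measurable
qed

lemma nn_integral_Qlaw:
  assumes "f \<in> borel_measurable borel"
  shows "(\<integral>\<^sup>+u. f u \<partial>Qlaw lam p \<nu>) = (\<integral>\<^sup>+u. ennreal (p u \<nu>) * f u \<partial>lam)"
proof -
  note [measurable_cong] = lam_sets
  note [measurable] = p_meas assms
  show ?thesis unfolding Qlaw_def by (subst nn_integral_density) auto
qed

lemma nn_integral_p: "(\<integral>\<^sup>+u. ennreal (p u \<nu>) \<partial>lam) = 1"
  using nn_integral_Qlaw[of "\<lambda>_. 1" \<nu>] prob_space.emeasure_space_1[OF Q_prob[of \<nu>]] by simp

text \<open>With the summed data laws disintegrated over \<open>u\<close>, unit \<open>j\<close> has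
  weight \<open>p u (\<nu> j)\<close>, exactly its weight in \<open>pstar\<close>. So
  \<open>sum_tail_level_le\<close> applies for each \<open>u\<close>, and integrating over
  \<open>lam\<close> uses that every density has total mass 1.\<close>

lemma compound_pstar:
  assumes a: "0 \<le> a"
  shows "(\<Sum>i<n. measure (data_law lam p F \<theta>0 (\<nu> i)) {z. pstar \<nu> n (fst z) (snd z) \<le> a}) \<le> real n * a"
proof (rule sum_measure_le)
  show "finite_measure (data_law lam p F \<theta>0 (\<nu> i))" for i
    using prob_space_data_law by (rule prob_space.finite_measure)
  let ?A = "{z. pstar \<nu> n (fst z) (snd z) \<le> a}"
  note [measurable] = borel_measurable_pstar p_meas
  note [measurable_cong] = lam_sets
  have "{z \<in> space (borel \<Otimes>\<^sub>M borel). pstar \<nu> n (fst z) (snd z) \<le> a} \<in> sets (borel \<Otimes>\<^sub>M borel)"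
    by measurable
  then have A [measurable]: "?A \<in> sets (borel \<Otimes>\<^sub>M borel)" by (simp add: space_pair_measure)
  define f where "f i u = measure (F \<theta>0 (\<nu> i) u) {t. pstar \<nu> n t u \<le> a}" for i u
  have f [measurable]: "f i \<in> borel_measurable borel" for i
    unfolding f_def
  proof (rule measure_measurable_subprob_algebra2[OF _ measurable_prob_algebraD[OF kernel]])
    \<comment> \<open>The kernel is indexed by \<open>u\<close>, so \<open>u\<close> must come
      first, whereas the data pairs have \<open>t\<close> first.\<close>
    have "(\<lambda>w. (snd w, fst w)) \<in> borel \<Otimes>\<^sub>M borel \<rightarrow>\<^sub>M (borel :: real measure) \<Otimes>\<^sub>M (borel :: 'u measure)"
      by simp
    from measurable_sets[OF this A]
    show "(SIGMA u:space borel. {t. pstar \<nu> n t u \<le> a}) \<in> sets ((borel :: 'u measure) \<Otimes>\<^sub>M (borel :: real measure))"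
      by (rule back_subst[of "\<lambda>X. X \<in> _"]) (auto simp: space_pair_measure)
  qed
  have f_nonneg: "0 \<le> f i u" for i u by (simp add: f_def)
  have le: "(\<Sum>i<n. p u (\<nu> i) * f i u) \<le> a * (\<Sum>i<n. p u (\<nu> i))" for u
  \<comment> \<open>If all densities vanish at \<open>u\<close>, then \<open>pstar\<close> is 0 by
    division by zero, but all the weights on the left vanish as well.\<close>
  proof (cases "(\<Sum>i<n. p u (\<nu> i)) = 0")
    case True
    then have "p u (\<nu> i) = 0" if "i < n" for i
      using that by (subst (asm) sum_nonneg_eq_0_iff) (auto simp: p_nonneg)
    then show ?thesis by simp
  next
    case False
    then have pos: "0 < (\<Sum>i<n. p u (\<nu> i))" using sum_nonneg[of "{..<n}" "\<lambda>i. p u (\<nu> i)"] p_nonneg by simp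
    \<comment> \<open>Clearing the denominator turns the event into a level set of the weighted tail
      function, with level \<open>a\<close> times the total density.\<close>
    have "pstar \<nu> n t u \<le> a \<longleftrightarrow>
      (\<Sum>j<n. p u (\<nu> j) * measure (F \<theta>0 (\<nu> j) u) {s. \<bar>t\<bar> \<le> \<bar>s\<bar>}) \<le> a * (\<Sum>i<n. p u (\<nu> i))" for t
      using pos by (simp add: pstar_def Por_def pos_divide_le_eq mult.commute)
    then show ?thesis
      unfolding f_def
      using sum_tail_level_le[of "{..<n}" "\<lambda>j. F \<theta>0 (\<nu> j) u" "\<lambda>j. p u (\<nu> j)" "a * (\<Sum>i<n. p u (\<nu> i))"]
        pos a by (simp add: sets_F prob_space.finite_measure[OF F_prob] p_nonneg)
  qed
  have "emeasure (data_law lam p F \<theta>0 (\<nu> i)) ?A = (\<integral>\<^sup>+u. ennreal (p u (\<nu> i) * f i u) \<partial>lam)" for i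
  proof -
    have "emeasure (data_law lam p F \<theta>0 (\<nu> i)) ?A = (\<integral>\<^sup>+u. ennreal (f i u) \<partial>Qlaw lam p (\<nu> i))"
      unfolding emeasure_data_law[OF A] f_def
      using finite_measure.emeasure_eq_measure[OF prob_space.finite_measure[OF F_prob]] by simp
    then show ?thesis by (simp add: nn_integral_Qlaw ennreal_mult' p_nonneg)
  qed
  then have "(\<Sum>i<n. emeasure (data_law lam p F \<theta>0 (\<nu> i)) ?A) = (\<Sum>i<n. \<integral>\<^sup>+u. ennreal (p u (\<nu> i) * f i u) \<partial>lam)"
    by simp
  also have "\<dots> = (\<integral>\<^sup>+u. ennreal (\<Sum>i<n. p u (\<nu> i) * f i u) \<partial>lam)"
    by (subst nn_integral_sum[symmetric]) (auto simp: f_nonneg p_nonneg intro!: nn_integral_cong sum_ennreal)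
  also have "\<dots> \<le> (\<integral>\<^sup>+u. ennreal (a * (\<Sum>i<n. p u (\<nu> i))) \<partial>lam)"
    using le by (intro nn_integral_mono ennreal_leI)
  also have "\<dots> = ennreal a * (\<Sum>i<n. \<integral>\<^sup>+u. ennreal (p u (\<nu> i)) \<partial>lam)"
    using a by (subst nn_integral_sum[symmetric])
      (auto simp: nn_integral_cmult[symmetric] ennreal_mult' p_nonneg sum_nonneg intro!: nn_integral_cong)
  also have "\<dots> = ennreal (real n * a)"
    using a by (simp add: nn_integral_p ennreal_of_nat_eq_real_of_nat mult.commute flip: ennreal_mult)
  finally show "(\<Sum>i<n. emeasure (data_law lam p F \<theta>0 (\<nu> i)) ?A) \<le> ennreal (real n * a)" .
qed (use a in simp)

text \<open>The summed laws have density \<open>\<Sum>j<n. p u (\<nu> j)\<close> with respect to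
  \<open>lam\<close>, which on the event is below \<open>real n * \<eta>\<close>; integration over
  \<open>C\<close> gives the bound.\<close>

lemma low_density_bound:
  assumes C: "compact C" and \<eta>: "0 \<le> \<eta>"
  shows "(\<Sum>i<n. measure (Qlaw lam p (\<nu> i)) {u \<in> C. (\<Sum>j<n. p u (\<nu> j)) < real n * \<eta>})
    \<le> real n * (\<eta> * measure lam C)"
proof (rule sum_measure_le)
  show "finite_measure (Qlaw lam p (\<nu> i))" for i
    using Q_prob by (rule prob_space.finite_measure)
  note [measurable] = p_meas
  note [measurable_cong] = lam_sets
  have [measurable]: "C \<in> sets borel" using C by (intro borel_closed compact_imp_closed)
  let ?A = "{u \<in> C. (\<Sum>j<n. p u (\<nu> j)) < real n * \<eta>}"
  have A [measurable]: "?A \<in> sets borel" by measurable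
  have lamC: "emeasure lam C = ennreal (measure lam C)"
    using A4_fin[OF C] by (intro emeasure_eq_ennreal_measure) simp
  have "emeasure (Qlaw lam p (\<nu> i)) ?A = (\<integral>\<^sup>+u. ennreal (p u (\<nu> i) * indicator ?A u) \<partial>lam)" for i
    using nn_integral_Qlaw[of "indicator ?A" "\<nu> i"]
    by (simp add: ennreal_mult' p_nonneg ennreal_indicator)
  then have "(\<Sum>i<n. emeasure (Qlaw lam p (\<nu> i)) ?A) = (\<Sum>i<n. \<integral>\<^sup>+u. ennreal (p u (\<nu> i) * indicator ?A u) \<partial>lam)"
    by simp
  also have "\<dots> = (\<integral>\<^sup>+u. ennreal ((\<Sum>i<n. p u (\<nu> i)) * indicator ?A u) \<partial>lam)"
    by (subst nn_integral_sum[symmetric])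
      (auto simp: p_nonneg sum_distrib_right intro!: nn_integral_cong sum_ennreal)
  also have "\<dots> \<le> (\<integral>\<^sup>+u. ennreal (real n * \<eta>) * indicator C u \<partial>lam)"
    by (intro nn_integral_mono) (auto simp: indicator_def intro!: ennreal_leI)
  also have "\<dots> = ennreal (real n * \<eta>) * emeasure lam C" by (subst nn_integral_cmult_indicator) auto
  also have "\<dots> = ennreal (real n * (\<eta> * measure lam C))"
    unfolding lamC using \<eta> by (simp add: mult.assoc flip: ennreal_mult)
  finally show "(\<Sum>i<n. emeasure (Qlaw lam p (\<nu> i)) ?A) \<le> ennreal (real n * (\<eta> * measure lam C))" .
qed (use \<eta> in simp)

subsection \<open>The posterior mean\<close>

sublocale Prior: prob_space Prior by (rule Pi_prob)

lemma space_Prior: "space Prior = {G. sets G = sets borel \<and> prob_space G}"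
  using sets_eq_imp_space_eq[OF Pi_sets] by (simp add: space_prob_algebra)

lemma space_of_prior:
  assumes "G \<in> space Prior" shows "sets G = sets borel" "prob_space G" "space G = UNIV"
  using assms sets_eq_imp_space_eq[of G borel] by (auto simp: space_Prior)

lemma ident_Prior: "(\<lambda>G. G) \<in> Prior \<rightarrow>\<^sub>M subprob_algebra borel"
  by (intro measurable_prob_algebraD measurable_ident_sets Pi_sets)

lemma borel_measurable_integral_Prior:
  fixes h :: "'v \<Rightarrow> real"
  assumes "h \<in> borel_measurable borel"
  shows "(\<lambda>G. \<integral>\<nu>. h \<nu> \<partial>G) \<in> borel_measurable Prior"
  by (rule measurable_compose[OF ident_Prior integral_measurable_subprob_algebra[OF assms]])

lemma marg_nonneg: "0 \<le> marg p G u"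
  unfolding marg_def by (intro integral_nonneg_AE) (simp add: p_nonneg)

text \<open>Joint measurability in the prior draw and the observation. It is proved for the
  nonnegative integral and carried over, since \<open>p\<close> is nonnegative.\<close>

lemma borel_measurable_marg: "(\<lambda>w. marg p (fst w) (snd w)) \<in> borel_measurable (Prior \<Otimes>\<^sub>M borel)"
proof -
  have "(\<lambda>w. \<integral>\<^sup>+\<nu>. ennreal (p (snd w) \<nu>) \<partial>fst w) \<in> borel_measurable (Prior \<Otimes>\<^sub>M borel)"
  proof (rule nn_integral_measurable_subprob_algebra2)
    have "(\<lambda>w. (snd (fst w), snd w)) \<in> (Prior \<Otimes>\<^sub>M borel) \<Otimes>\<^sub>M borel \<rightarrow>\<^sub>M borel \<Otimes>\<^sub>M borel" by simp
    from measurable_compose[OF measurable_compose[OF this borel_measurable_p] measurable_ennreal]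
    show "(\<lambda>(w, \<nu>). ennreal (p (snd w) \<nu>)) \<in> borel_measurable ((Prior \<Otimes>\<^sub>M borel) \<Otimes>\<^sub>M borel)"
      by (simp add: case_prod_beta')
    show "fst \<in> Prior \<Otimes>\<^sub>M borel \<rightarrow>\<^sub>M subprob_algebra borel"
      by (rule measurable_compose[OF measurable_fst ident_Prior])
  qed
  then have "(\<lambda>w. enn2real (\<integral>\<^sup>+\<nu>. ennreal (p (snd w) \<nu>) \<partial>fst w)) \<in> borel_measurable (Prior \<Otimes>\<^sub>M borel)"
    by simp
  moreover have "marg p (fst w) (snd w) = enn2real (\<integral>\<^sup>+\<nu>. ennreal (p (snd w) \<nu>) \<partial>fst w)"
    if "w \<in> space (Prior \<Otimes>\<^sub>M borel)" for w
  proof -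
    have "sets (fst w) = sets borel" using that space_of_prior by (auto simp: space_pair_measure)
    then have "p (snd w) \<in> borel_measurable (fst w)"
      using borel_measurable_p_nuisance by (subst measurable_cong_sets[OF _ refl])
    then show ?thesis unfolding marg_def by (intro integral_eq_nn_integral) (auto simp: p_nonneg)
  qed
  ultimately show ?thesis by (subst measurable_cong) auto
qed

lemma prior_integral_bound:
  fixes h :: "'v \<Rightarrow> real"
  assumes "G \<in> space Prior" "h \<in> borel_measurable borel" "\<And>\<nu>. \<bar>h \<nu>\<bar> \<le> B"
  shows "\<bar>\<integral>\<nu>. h \<nu> \<partial>G\<bar> \<le> B"
proof (rule abs_integral_le_subprob(2))
  show "subprob_space G" using space_of_prior[OF assms(1)] by (simp add: prob_space_imp_subprob_space)
  show "h \<in> borel_measurable G"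
    using assms(2) by (subst measurable_cong_sets[OF space_of_prior(1)[OF assms(1)] refl])
qed fact

lemma marg_le:
  assumes "G \<in> space Prior" "\<And>\<nu>. p u \<nu> \<le> B" shows "marg p G u \<le> B"
  using prior_integral_bound[OF assms(1) borel_measurable_p_nuisance, of u B] assms(2) p_nonneg
  by (auto simp: marg_def)

lemma lik_nonneg: "0 \<le> lik p G J u"
  unfolding lik_def by (intro prod_nonneg) (simp add: marg_nonneg)

lemma lik_le:
  obtains B where "\<And>G. G \<in> space Prior \<Longrightarrow> lik p G J u \<le> B"
proof -
  have "\<exists>B. \<forall>\<nu>. p (u j) \<nu> \<le> B" for j using p_le by metis
  then obtain B where "\<And>j \<nu>. p (u j) \<nu> \<le> B j" by metis
  then have "lik p G J u \<le> (\<Prod>j\<in>J. B j)" if "G \<in> space Prior" for G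
    unfolding lik_def using that by (intro prod_mono) (auto intro: marg_nonneg marg_le)
  then show thesis by (rule that)
qed

lemma borel_measurable_lik:
  "(\<lambda>w. lik p (snd w) J (fst w)) \<in> borel_measurable (PiM J (\<lambda>_. borel) \<Otimes>\<^sub>M Prior)"
  unfolding lik_def
proof (rule borel_measurable_prod)
  fix j assume "j \<in> J"
  then have "(\<lambda>w. (snd w, fst w j)) \<in> PiM J (\<lambda>_. borel) \<Otimes>\<^sub>M Prior \<rightarrow>\<^sub>M Prior \<Otimes>\<^sub>M borel" by measurable
  from measurable_compose[OF this borel_measurable_marg]
  show "(\<lambda>w. marg p (snd w) (fst w j)) \<in> borel_measurable (PiM J (\<lambda>_. borel) \<Otimes>\<^sub>M Prior)" by simp
qed

lemma borel_measurable_lik_Prior: "(\<lambda>G. lik p G J u) \<in> borel_measurable Prior"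
  unfolding lik_def
proof (rule borel_measurable_prod)
  fix j
  have "(\<lambda>G. (G, u j)) \<in> Prior \<rightarrow>\<^sub>M Prior \<Otimes>\<^sub>M borel" by measurable
  from measurable_compose[OF this borel_measurable_marg]
  show "(\<lambda>G. marg p G (u j)) \<in> borel_measurable Prior" by simp
qed

lemma integrable_lik:
  assumes "f \<in> borel_measurable Prior" "\<And>G. G \<in> space Prior \<Longrightarrow> \<bar>f G\<bar> \<le> B"
  shows "integrable Prior (\<lambda>G. f G * lik p G J u)"
proof -
  obtain B' where B': "\<And>G. G \<in> space Prior \<Longrightarrow> lik p G J u \<le> B'" using lik_le by blast
  show ?thesis
  proof (rule Prior.integrable_const_bound[of _ "B * B'"])
    show "AE G in Prior. norm (f G * lik p G J u) \<le> B * B'"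
    proof (rule AE_I2)
      fix G assume G: "G \<in> space Prior"
      have "\<bar>f G\<bar> * lik p G J u \<le> B * B'"
        using assms(2)[OF G] B'[OF G] lik_nonneg[of G J u] by (intro mult_mono) auto
      then show "norm (f G * lik p G J u) \<le> B * B'" by (simp add: abs_mult lik_nonneg)
    qed
    show "(\<lambda>G. f G * lik p G J u) \<in> borel_measurable Prior"
      using assms(1) borel_measurable_lik_Prior by (rule borel_measurable_times)
  qed
qed

text \<open>The marginal density of the observations under the hierarchical model, that is, the
  normalising constant of the Bayes formula.\<close>

definition evidence :: "nat set \<Rightarrow> (nat \<Rightarrow> 'u) \<Rightarrow> real" where
  "evidence J u = (\<integral>G. lik p G J u \<partial>Prior)"

lemma evidence_nonneg: "0 \<le> evidence J u"
  unfolding evidence_def by (intro integral_nonneg_AE) (simp add: lik_nonneg)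

definition posterior :: "nat set \<Rightarrow> (nat \<Rightarrow> 'u) \<Rightarrow> 'v measure measure" where
  "posterior J u = density Prior (\<lambda>G. ennreal (lik p G J u / evidence J u))"

lemma post_mean_eq: "post_mean Prior p J u = posterior J u \<bind> (\<lambda>G. G)"
  by (simp add: post_mean_def posterior_def evidence_def)

lemma sets_posterior [simp, measurable_cong]: "sets (posterior J u) = sets Prior"
  and space_posterior [simp]: "space (posterior J u) = space Prior"
  by (simp_all add: posterior_def)

lemma ident_posterior: "(\<lambda>G. G) \<in> posterior J u \<rightarrow>\<^sub>M subprob_algebra borel"
  using ident_Prior by (subst measurable_cong_sets[OF sets_posterior refl])

text \<open>When the evidence vanishes, division by zero makes the posterior the null measure.\<close>
lemma subprob_space_posterior: "subprob_space (posterior J u)"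
proof
  note [measurable] = borel_measurable_lik_Prior
  have int: "integrable Prior (\<lambda>G. lik p G J u)"
    using integrable_lik[of "\<lambda>_. 1" 1] by simp
  have "emeasure (posterior J u) (space (posterior J u)) = (\<integral>\<^sup>+G. ennreal (lik p G J u / evidence J u) \<partial>Prior)"
    unfolding posterior_def by (subst emeasure_density) (auto intro!: nn_integral_cong)
  also have "\<dots> = ennreal (\<integral>G. lik p G J u / evidence J u \<partial>Prior)"
    using int by (intro nn_integral_eq_integral) (auto simp: lik_nonneg evidence_nonneg)
  also have "(\<integral>G. lik p G J u / evidence J u \<partial>Prior) = evidence J u / evidence J u"
    by (simp add: evidence_def)
  also have "ennreal \<dots> \<le> 1" by simp
  finally show "emeasure (posterior J u) (space (posterior J u)) \<le> 1" .
  show "space (posterior J u) \<noteq> {}" using Prior.not_empty by simp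
qed

lemma sets_post_mean: "sets (post_mean Prior p J u) = sets borel"
  unfolding post_mean_eq by (rule sets_bind) (use space_of_prior(1) Prior.not_empty in auto)

lemma space_post_mean: "space (post_mean Prior p J u) = UNIV"
  using sets_eq_imp_space_eq[OF sets_post_mean] by simp

lemma subprob_space_post_mean: "subprob_space (post_mean Prior p J u)"
  unfolding post_mean_eq by (rule subprob_space_bind[OF subprob_space_posterior ident_posterior])

text \<open>The posterior mean is the join of the posterior law of \<open>G\<close>, so integrating
  against it averages the integrals against \<open>G\<close>. The identity includes zero evidence,
  where both sides are 0.\<close>

lemma integral_post_mean:
  fixes h :: "'v \<Rightarrow> real"
  assumes h: "h \<in> borel_measurable borel" "\<And>\<nu>. \<bar>h \<nu>\<bar> \<le> B"
  shows "(\<integral>\<nu>. h \<nu> \<partial>post_mean Prior p J u) = (\<integral>G. (\<integral>\<nu>. h \<nu> \<partial>G) * lik p G J u \<partial>Prior) / evidence J u"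
proof -
  interpret P: subprob_space "posterior J u" by (rule subprob_space_posterior)
  note [measurable] = borel_measurable_lik_Prior borel_measurable_integral_Prior[OF h(1)]
  have "(\<integral>\<nu>. h \<nu> \<partial>post_mean Prior p J u) =
      (\<integral>\<nu>. h \<nu> \<partial>join (distr (posterior J u) (subprob_algebra borel) (\<lambda>G. G)))"
    unfolding post_mean_eq by (subst bind_nonempty''[OF ident_posterior]) (simp_all add: Prior.not_empty)
  also have "\<dots> = (\<integral>G. (\<integral>\<nu>. h \<nu> \<partial>G) \<partial>distr (posterior J u) (subprob_algebra borel) (\<lambda>G. G))"
  proof (rule integral_join[where B'=1])
    show "finite_measure (distr (posterior J u) (subprob_algebra borel) (\<lambda>G. G))"
      by (rule P.finite_measure_distr[OF ident_posterior])
    show "AE G in distr (posterior J u) (subprob_algebra borel) (\<lambda>G. G). emeasure G (space G) \<le> ennreal 1"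
      by (rule AE_I2) (auto simp: space_subprob_algebra subprob_space.subprob_emeasure_le_1)
  qed (use h in auto)
  also have "\<dots> = (\<integral>G. (\<integral>\<nu>. h \<nu> \<partial>G) \<partial>posterior J u)"
    by (rule integral_distr[OF ident_posterior integral_measurable_subprob_algebra[OF h(1)]])
  also have "\<dots> = (\<integral>G. (lik p G J u / evidence J u) *\<^sub>R (\<integral>\<nu>. h \<nu> \<partial>G) \<partial>Prior)"
    unfolding posterior_def
    by (rule integral_density) (auto simp: lik_nonneg evidence_nonneg)
  also have "\<dots> = (\<integral>G. (\<integral>\<nu>. h \<nu> \<partial>G) * lik p G J u / evidence J u \<partial>Prior)"
    by (simp add: mult.commute)
  finally show ?thesis by simp
qed

lemma borel_measurable_integral_post_mean:
  fixes h :: "'v \<Rightarrow> real"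
  assumes h: "h \<in> borel_measurable borel" "\<And>\<nu>. \<bar>h \<nu>\<bar> \<le> B"
  shows "(\<lambda>u. \<integral>\<nu>. h \<nu> \<partial>post_mean Prior p J u) \<in> borel_measurable (PiM J (\<lambda>_. borel))"
proof -
  note [measurable] = borel_measurable_lik borel_measurable_integral_Prior[OF h(1)]
  show ?thesis
    unfolding integral_post_mean[OF h] evidence_def
    by (intro borel_measurable_divide Prior.borel_measurable_lebesgue_integral)
      (simp_all add: case_prod_beta')
qed

lemma post_mean_cong:
  assumes "\<And>j. j \<in> J \<Longrightarrow> u j = u' j"
  shows "post_mean Prior p J u = post_mean Prior p J u'"
proof -
  have "lik p G J u = lik p G J u'" for G unfolding lik_def using assms by (intro prod.cong) auto
  then show ?thesis by (simp add: post_mean_def)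
qed

text \<open>The likelihood factors into the contribution of unit \<open>i\<close> and that of the
  others. Dividing numerator and denominator by the evidence of the others turns both into integrals
  against their posterior mean, which thus acts as a plug-in prior.\<close>

lemma pval_eq:
  assumes i: "i < n" and ev: "evidence ({..<n} - {i}) u \<noteq> 0"
  defines "Ghat \<equiv> post_mean Prior p ({..<n} - {i}) u"
  shows "pval Prior p F \<theta>0 n i t u = (\<integral>\<nu>. Por F \<theta>0 t (u i) \<nu> * p (u i) \<nu> \<partial>Ghat) / (\<integral>\<nu>. p (u i) \<nu> \<partial>Ghat)"
proof -
  obtain B where B: "\<And>\<nu>. p (u i) \<nu> \<le> B" using p_le by blast
  have pB: "\<bar>p (u i) \<nu>\<bar> \<le> B" for \<nu> using B p_nonneg by simp
  have PB: "\<bar>Por F \<theta>0 t (u i) \<nu> * p (u i) \<nu>\<bar> \<le> B" for \<nu>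
    using mult_mono[OF Por_bounds(2) B] p_nonneg[of "u i" \<nu>] Por_bounds(1)[of \<theta>0 t "u i" \<nu>]
    by (simp add: abs_mult)
  have meas: "(\<lambda>\<nu>. Por F \<theta>0 t (u i) \<nu> * p (u i) \<nu>) \<in> borel_measurable borel"
    by (intro borel_measurable_continuous_onI continuous_intros continuous_Por continuous_p)
  have "lik p G {..<n} u = (\<integral>\<nu>. p (u i) \<nu> \<partial>G) * lik p G ({..<n} - {i}) u" for G
    unfolding lik_def using i by (subst prod.remove[of _ i]) (auto simp: marg_def)
  then show ?thesis
    unfolding pval_def Ghat_def integral_post_mean[OF meas PB]
      integral_post_mean[OF borel_measurable_p_nuisance pB]
    using ev by simp
qed

lemma integral_emp_others:
  fixes h :: "'v \<Rightarrow> real"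
  assumes "2 \<le> n" "i < n"
  shows "(\<integral>x. h x \<partial>emp_others \<nu> n i) = (\<Sum>j\<in>{..<n} - {i}. h (\<nu> j)) / real (n - 1)"
proof -
  \<comment> \<open>The uniform distribution requires a nonempty set; as \<open>n\<close> is at
    least 2, one of the units 0 and 1 differs from \<open>i\<close>.\<close>
  have "(if i = 0 then 1 else 0) \<in> {..<n} - {i}" using assms by auto
  then have ne: "{..<n} - {i} \<noteq> {}" by blast
  show ?thesis
    unfolding emp_others_def using assms by (simp add: integral_pmf_of_set[OF ne] of_nat_diff)
qed

lemma two_subprobs_post_mean: "two_subprobs (post_mean Prior p J u) (emp_others \<nu> n i)"
  by (rule two_subprobs.intro)
    (simp_all add: subprob_space_post_mean sets_post_mean space_post_mean emp_others_def
      measure_pmf.subprob_space_axioms)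

text \<open>For zero evidence the posterior mean is the null measure, at distance at least 1 from any
  probability measure.\<close>
lemma evidence_nonzero_of_DBL_less:
  assumes "DBL (post_mean Prior p J u) (emp_others \<nu> n i) < 1"
  shows "evidence J u \<noteq> 0"
proof
  assume "evidence J u = 0"
  then have "(\<integral>\<nu>. (1::real) \<partial>post_mean Prior p J u) = 0"
    using integral_post_mean[of "\<lambda>_. 1" 1 J u] by simp
  moreover have "(\<integral>\<nu>. (1::real) \<partial>emp_others \<nu> n i) = 1" by (simp add: emp_others_def)
  ultimately show False
    using two_subprobs.DBL_upper[OF two_subprobs_post_mean, of "\<lambda>_. 1" J u \<nu> n i] assms
    by (simp add: BL_ball_def)
qed

text \<open>The convergence hypothesis concerns leave-one-out empirical measures, while
  \<open>pstar\<close> needs one measure common to all units. The two averages differ by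
  \<open>(S / real n - h (\<nu> i)) / (real n - 1)\<close>.\<close>

lemma empirical_integral_diff:
  fixes h :: "'v \<Rightarrow> real"
  assumes n: "2 \<le> n" "i < n" and B: "\<And>x. \<bar>h x\<bar> \<le> B"
  shows "\<bar>(\<integral>x. h x \<partial>emp_others \<nu> n i) - (\<Sum>j<n. h (\<nu> j)) / real n\<bar> \<le> 2 * B / real (n - 1)"
proof -
  define S where "S = (\<Sum>j<n. h (\<nu> j))"
  have split: "(\<Sum>j\<in>{..<n} - {i}. h (\<nu> j)) = S - h (\<nu> i)"
    unfolding S_def using n by (simp add: sum_diff1)
  have n': "real (n - 1) = real n - 1" "1 < real n" using n by (auto simp: of_nat_diff)
  have "\<bar>S\<bar> \<le> (\<Sum>j<n. B)" unfolding S_def by (rule order_trans[OF sum_abs sum_mono]) (use B in auto)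
  then have S: "\<bar>S / real n\<bar> \<le> B" using n' by (simp add: field_simps)
  have "(S - h (\<nu> i)) / (real n - 1) - S / real n = (S / real n - h (\<nu> i)) / (real n - 1)"
    using n' by (simp add: field_simps)
  also have "\<bar>\<dots>\<bar> = \<bar>S / real n - h (\<nu> i)\<bar> / (real n - 1)" using n' by simp
  also have "\<dots> \<le> 2 * B / (real n - 1)"
    using n' S B[of "\<nu> i"] by (intro divide_right_mono) linarith+
  finally show ?thesis unfolding integral_emp_others[OF n] split S_def[symmetric] n'(1) .
qed

subsection \<open>Comparison with the oracle p-value\<close>

text \<open>The thresholds depend on \<open>C\<close>, \<open>\<epsilon>\<close> and
  \<open>\<eta>\<close> only, so the comparison is uniform in units, parameters and data. A
  one-sided estimate is enough: a small p-value has to force a small \<open>pstar\<close>.\<close>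

lemma pstar_le_pval:
  assumes C: "compact C" and \<epsilon>: "0 < \<epsilon>" "\<epsilon> \<le> 1" and \<eta>: "0 < \<eta>"
  obtains \<kappa> N where "0 < \<kappa>"
    "\<And>n i \<nu> t u. \<lbrakk>N \<le> n; i < n; u i \<in> C; real n * \<eta> \<le> (\<Sum>j<n. p (u i) (\<nu> j));
        DBL (post_mean Prior p ({..<n} - {i}) u) (emp_others \<nu> n i) < \<kappa>\<rbrakk>
      \<Longrightarrow> pstar \<nu> n t (u i) \<le> pval Prior p F \<theta>0 n i t u + \<epsilon>"
proof -
  \<comment> \<open>Numerator and denominator will each be off by at most \<open>4 * r\<close>,
    together \<open>8 * r\<close>, which equals \<open>\<epsilon> * \<eta>\<close> and is at most
    \<open>\<epsilon>\<close> times the denominator.\<close>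
  define r where "r = \<eta> * \<epsilon> / 8"
  have r: "0 < r" using \<epsilon> \<eta> by (simp add: r_def)
  obtain B0 where B0: "\<And>u \<nu>. u \<in> C \<Longrightarrow> \<bar>p u \<nu>\<bar> \<le> B0" using A4_bdd[OF C] by blast
  define B where "B = \<bar>B0\<bar> + 1"
  have B: "0 < B" by (simp add: B_def)
  have p_B: "p u \<nu> \<le> B" if "u \<in> C" for u \<nu>
    using B0[OF that, of \<nu>] unfolding B_def by linarith
  \<comment> \<open>The product of \<open>Por\<close> and \<open>p\<close> then oscillates by at
    most \<open>r\<close>: half of it from \<open>Por\<close>, multiplied by at most
    \<open>B\<close>, and half from \<open>p\<close>, multiplied by at most 1.\<close>
  obtain \<delta>1 where \<delta>1: "0 < \<delta>1" "\<And>t u \<nu> \<nu>'. dist \<nu> \<nu>' < \<delta>1 \<Longrightarrow> \<bar>Por F \<theta>0 t u \<nu> - Por F \<theta>0 t u \<nu>'\<bar> < r / (2 * B)"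
    using A3[rule_format, of "r / (2 * B)"] r B by auto
  obtain \<delta>2 where \<delta>2: "0 < \<delta>2" "\<And>u \<nu> \<nu>'. u \<in> C \<Longrightarrow> dist \<nu> \<nu>' < \<delta>2 \<Longrightarrow> \<bar>p u \<nu> - p u \<nu>'\<bar> < r / 2"
    using A4_eqc[OF C, rule_format, of "r / 2"] r by auto
  define \<delta> where "\<delta> = min \<delta>1 \<delta>2"
  have \<delta>: "0 < \<delta>" using \<delta>1 \<delta>2 by (simp add: \<delta>_def)
  define K where "K = 1 + B + 2 * B / \<delta>"
  have K: "0 < K" using B \<delta> by (simp add: K_def add_pos_pos)
  \<comment> \<open>The bound 1 excludes zero evidence; the bound \<open>r / K\<close> keeps the
    contribution of the distance below \<open>r\<close>.\<close>
  define \<kappa> where "\<kappa> = min 1 (r / K)"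
  have \<kappa>: "0 < \<kappa>" using r K by (simp add: \<kappa>_def)
  obtain N0 :: nat where N0: "2 * B / r < real N0" using reals_Archimedean2 by blast
  show thesis
  proof (rule that[OF \<kappa>, of "N0 + 2"])
    fix n i \<nu> t and u :: "nat \<Rightarrow> 'u"
    assume n: "N0 + 2 \<le> n" "i < n" and ui: "u i \<in> C"
      and dens: "real n * \<eta> \<le> (\<Sum>j<n. p (u i) (\<nu> j))"
      and D: "DBL (post_mean Prior p ({..<n} - {i}) u) (emp_others \<nu> n i) < \<kappa>"
    let ?G = "post_mean Prior p ({..<n} - {i}) u"
    have n2: "2 \<le> n" "0 < real n" using n by auto
    interpret two_subprobs ?G "emp_others \<nu> n i" by (rule two_subprobs_post_mean)
    have "real N0 \<le> real (n - 1)" using n by linarith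
    then have "2 * B / r < real (n - 1)" using N0 by linarith
    then have Nr: "2 * B / real (n - 1) \<le> r" using r n n2 by (simp add: field_simps)
    have KD: "K * DBL ?G (emp_others \<nu> n i) \<le> r"
    proof -
      have "DBL ?G (emp_others \<nu> n i) \<le> r / K" using D by (simp add: \<kappa>_def)
      then show ?thesis using K by (simp add: field_simps)
    qed
    \<comment> \<open>Of the \<open>4 * r\<close>, two come from the Lipschitz approximation, one
      from the distance and one from restoring unit \<open>i\<close> to the empirical
      measure.\<close>
    have approx: "\<bar>(\<integral>x. h x \<partial>?G) - (\<Sum>j<n. h (\<nu> j)) / real n\<bar> \<le> 4 * r"
      if h: "h \<in> borel_measurable borel" "\<And>x. \<bar>h x\<bar> \<le> B" "\<And>x y. dist x y < \<delta> \<Longrightarrow> \<bar>h x - h y\<bar> \<le> r"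
      for h :: "'v \<Rightarrow> real"
    proof -
      have "\<bar>(\<integral>x. h x \<partial>?G) - (\<integral>x. h x \<partial>emp_others \<nu> n i)\<bar>
          \<le> 2 * r + K * DBL ?G (emp_others \<nu> n i)"
        unfolding K_def by (intro integral_diff_le_DBL h \<delta>)
      moreover have "\<bar>(\<integral>x. h x \<partial>emp_others \<nu> n i) - (\<Sum>j<n. h (\<nu> j)) / real n\<bar> \<le> r"
        by (rule order_trans[OF empirical_integral_diff[OF n2(1) n(2) h(2)] Nr])
      ultimately show ?thesis using KD by linarith
    qed
    define h where "h \<nu> = Por F \<theta>0 t (u i) \<nu> * p (u i) \<nu>" for \<nu>
    have p01: "0 \<le> p (u i) x" "p (u i) x \<le> B" for x using p_nonneg p_B[OF ui] by auto
    have hp: "0 \<le> h x" "h x \<le> p (u i) x" for x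
      using Por_bounds p01 by (auto simp: h_def mult_left_le_one_le)
    have h_meas: "h \<in> borel_measurable borel" unfolding h_def
      by (intro borel_measurable_continuous_onI continuous_intros continuous_Por continuous_p)
    have h_unif: "\<bar>h x - h y\<bar> \<le> r" if "dist x y < \<delta>" for x y
    proof -
      have "h x - h y = (Por F \<theta>0 t (u i) x - Por F \<theta>0 t (u i) y) * p (u i) x
          + Por F \<theta>0 t (u i) y * (p (u i) x - p (u i) y)"
        by (simp add: h_def algebra_simps)
      also have "\<bar>\<dots>\<bar> \<le> \<bar>Por F \<theta>0 t (u i) x - Por F \<theta>0 t (u i) y\<bar> * \<bar>p (u i) x\<bar>
          + \<bar>Por F \<theta>0 t (u i) y\<bar> * \<bar>p (u i) x - p (u i) y\<bar>"
        by (metis abs_mult abs_triangle_ineq)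
      also have "\<dots> \<le> r / (2 * B) * B + 1 * (r / 2)"
        using \<delta>1(2)[of x y t "u i"] \<delta>2(2)[OF ui, of x y] that p01 Por_bounds r B
        by (intro add_mono mult_mono) (auto simp: \<delta>_def)
      also have "\<dots> = r" using B by (simp add: field_simps)
      finally show ?thesis .
    qed
    have p_unif: "\<bar>p (u i) x - p (u i) y\<bar> \<le> r" if "dist x y < \<delta>" for x y
      using \<delta>2(2)[OF ui, of x y] that r by (auto simp: \<delta>_def)
    define num where "num = (\<Sum>j<n. h (\<nu> j)) / real n"
    define den where "den = (\<Sum>j<n. p (u i) (\<nu> j)) / real n"
    define num' where "num' = (\<integral>x. h x \<partial>?G)"
    define den' where "den' = (\<integral>x. p (u i) x \<partial>?G)"
    have close: "\<bar>num' - num\<bar> \<le> 4 * r" "\<bar>den' - den\<bar> \<le> 4 * r"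
      unfolding num_def num'_def den_def den'_def
      using hp p01 by (intro approx h_meas borel_measurable_p_nuisance h_unif p_unif; simp add: order_trans[OF hp(2) p01(2)])+
    have den: "\<eta> \<le> den" using dens n2 by (simp add: den_def field_simps)
    have "4 * r \<le> \<eta> / 2" using \<epsilon> \<eta> by (simp add: r_def field_simps)
    then have den': "0 < den'" using close(2) den \<eta> by linarith
    have num': "0 \<le> num'" "num' \<le> den'"
    proof -
      have "\<bar>h x\<bar> \<le> B" for x using hp[of x] p01[of x] by linarith
      then have "integrable ?G h" by (rule abs_integral_le_subprob(1)[OF G(1) borel_measurable(1)[OF h_meas]])
      moreover have "\<bar>p (u i) x\<bar> \<le> B" for x using p01[of x] by simp
      then have "integrable ?G (p (u i))"
        by (rule abs_integral_le_subprob(1)[OF G(1) borel_measurable(1)[OF borel_measurable_p_nuisance]])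
      ultimately show "num' \<le> den'" unfolding num'_def den'_def by (rule integral_mono) (rule hp)
      show "0 \<le> num'" unfolding num'_def by (rule integral_nonneg_AE) (simp add: hp)
    qed
    have "num / den - num' / den' \<le> \<epsilon>"
    proof -
      have pos: "0 < den" using den \<eta> by linarith
      \<comment> \<open>Because the ratio \<open>num' / den'\<close> is at most 1, an error of
        \<open>4 * r\<close> in the denominator costs at most \<open>4 * r\<close> after
        multiplication by it.\<close>
      have q: "0 \<le> num' / den'" "num' / den' \<le> 1" using num' den' by auto
      have "num \<le> num' + 4 * r" using close(1) by linarith
      also have "num' = num' / den' * den'" using den' by simp
      also have "num' / den' * den' \<le> num' / den' * (den + 4 * r)"
        using close(2) q(1) by (intro mult_left_mono) auto
      also have "\<dots> \<le> num' / den' * den + 4 * r"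
        using mult_right_mono[OF q(2), of "4 * r"] r by (simp add: distrib_left)
      finally have "num \<le> num' / den' * den + 8 * r" by simp
      also have "8 * r = \<epsilon> * \<eta>" by (simp add: r_def)
      also have "\<epsilon> * \<eta> \<le> \<epsilon> * den" using den \<epsilon> by (intro mult_left_mono) auto
      finally have "num \<le> (num' / den' + \<epsilon>) * den" by (simp add: distrib_right)
      then show ?thesis using pos by (simp add: pos_divide_le_eq[symmetric] diff_le_eq add.commute)
    qed
    moreover have "pstar \<nu> n t (u i) = num / den"
      using n2 by (simp add: pstar_def num_def den_def h_def)
    moreover have "pval Prior p F \<theta>0 n i t u = num' / den'"
      unfolding num'_def den'_def h_def
    proof (rule pval_eq[OF n(2)])
      show "evidence ({..<n} - {i}) u \<noteq> 0"
        using D by (intro evidence_nonzero_of_DBL_less[of _ _ \<nu> n i]) (simp add: \<kappa>_def)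
    qed
    ultimately show "pstar \<nu> n t (u i) \<le> pval Prior p F \<theta>0 n i t u + \<epsilon>" by simp
  qed
qed

subsection \<open>Bounding the rejection probabilities\<close>

lemma sets_PiM_Qlaw: "sets (PiM J (\<lambda>j. Qlaw lam p (\<nu> j))) = sets (PiM J (\<lambda>_. borel))"
  by (rule sets_PiM_cong) auto

lemma borel_measurable_DBL_post_mean:
  "(\<lambda>u. DBL (post_mean Prior p J u) (emp_others \<nu> n i)) \<in> borel_measurable (PiM J (\<lambda>_. borel))"
  by (intro borel_measurable_DBL A2 two_subprobs_post_mean
      borel_measurable_integral_post_mean[where B=1] BL_ball_measurable BL_ballD(1))

lemma DBL_markov:
  assumes \<kappa>: "0 < \<kappa>"
  shows "measure (PiM ({..<n} - {i}) (\<lambda>j. Qlaw lam p (\<nu> j)))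
      {u \<in> space (PiM ({..<n} - {i}) (\<lambda>j. Qlaw lam p (\<nu> j))).
        \<kappa> \<le> DBL (post_mean Prior p ({..<n} - {i}) u) (emp_others \<nu> n i)}
    \<le> post_err lam p Prior \<nu> n i / \<kappa>"
  unfolding post_err_def
proof (rule integral_Markov_inequality_measure[OF _ _ _ \<kappa>])
  let ?M = "PiM ({..<n} - {i}) (\<lambda>j. Qlaw lam p (\<nu> j))"
  let ?D = "\<lambda>u. DBL (post_mean Prior p ({..<n} - {i}) u) (emp_others \<nu> n i)"
  interpret M: prob_space ?M by (rule prob_space_PiM[OF Q_prob])
  have m: "?D \<in> borel_measurable ?M"
    using borel_measurable_DBL_post_mean by (subst measurable_cong_sets[OF sets_PiM_Qlaw refl])
  show "integrable ?M ?D"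
    using two_subprobs.DBL_le_2[OF two_subprobs_post_mean]
      two_subprobs.DBL_nonneg[OF two_subprobs_post_mean]
    by (intro M.integrable_const_bound[OF _ m, of 2] AE_I2) simp
  show "AE u in ?M. 0 \<le> ?D u" using two_subprobs.DBL_nonneg[OF two_subprobs_post_mean] by simp
  show "space ?M \<in> sets ?M" by (rule sets.top)
qed

text \<open>Outside three exceptional events a rejection forces \<open>pstar\<close> to be at most
  \<open>\<alpha> + \<epsilon>\<close>. The exceptions are an observation outside \<open>C\<close>,
  a low mixture density at it, and a poor posterior mean; each term on the right bounds one event of
  the union.\<close>

lemma rej_prob_le:
  assumes i: "i < n" "\<theta> i = \<theta>0" and C: "compact C" and \<kappa>: "0 < \<kappa>"
    and le: "\<And>t u. \<lbrakk>u i \<in> C; real n * \<eta> \<le> (\<Sum>j<n. p (u i) (\<nu> j));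
        DBL (post_mean Prior p ({..<n} - {i}) u) (emp_others \<nu> n i) < \<kappa>\<rbrakk>
      \<Longrightarrow> pstar \<nu> n t (u i) \<le> pval Prior p F \<theta>0 n i t u + \<epsilon>"
  shows "rej_prob lam p F \<theta>0 Prior \<theta> \<nu> n i \<alpha>
    \<le> measure (data_law lam p F \<theta>0 (\<nu> i)) {z. pstar \<nu> n (fst z) (snd z) \<le> \<alpha> + \<epsilon>}
      + measure (Qlaw lam p (\<nu> i)) (- C)
      + measure (Qlaw lam p (\<nu> i)) {u \<in> C. (\<Sum>j<n. p u (\<nu> j)) < real n * \<eta>}
      + post_err lam p Prior \<nu> n i / \<kappa>"
proof -
  let ?J = "{..<n} - {i}"
  define D where "D = PiM {..<n} (\<lambda>j. data_law lam p F (\<theta> j) (\<nu> j))"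
  interpret D: prob_space D unfolding D_def by (rule prob_space_PiM[OF prob_space_data_law])
  have component: "{\<omega> \<in> space D. \<omega> i \<in> A} \<in> sets D"
    "measure D {\<omega> \<in> space D. \<omega> i \<in> A} = measure (data_law lam p F \<theta>0 (\<nu> i)) A"
    if A: "A \<in> sets (borel \<Otimes>\<^sub>M borel)" for A
  proof -
    have proj: "(\<lambda>\<omega>. \<omega> i) \<in> D \<rightarrow>\<^sub>M data_law lam p F (\<theta> i) (\<nu> i)"
      unfolding D_def using i by (intro measurable_component_singleton) simp
    have eq: "{\<omega> \<in> space D. \<omega> i \<in> A} = (\<lambda>\<omega>. \<omega> i) -` A \<inter> space D" by auto
    show "{\<omega> \<in> space D. \<omega> i \<in> A} \<in> sets D"
      unfolding eq using A by (intro measurable_sets[OF proj]) simp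
    have "distr D (data_law lam p F (\<theta> i) (\<nu> i)) (\<lambda>\<omega>. \<omega> i) = data_law lam p F (\<theta> i) (\<nu> i)"
      unfolding D_def using i
      by (intro distr_PiM_component[of _ "\<lambda>j. data_law lam p F (\<theta> j) (\<nu> j)"] prob_space_data_law) simp
    then have "measure (data_law lam p F \<theta>0 (\<nu> i)) A =
        measure (distr D (data_law lam p F (\<theta> i) (\<nu> i)) (\<lambda>\<omega>. \<omega> i)) A" using i(2) by simp
    also have "\<dots> = measure D {\<omega> \<in> space D. \<omega> i \<in> A}"
      unfolding eq using A by (intro measure_distr[OF proj]) simp
    finally show "measure D {\<omega> \<in> space D. \<omega> i \<in> A} = measure (data_law lam p F \<theta>0 (\<nu> i)) A" ..
  qed
  have snd_sets: "{z :: real \<times> 'u. snd z \<in> A} \<in> sets (borel \<Otimes>\<^sub>M borel)" if "A \<in> sets borel" for A :: "'u set"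
    using measurable_sets[OF measurable_snd that, of "borel :: real measure"]
    by (simp add: space_pair_measure vimage_def)
  have C_sets: "C \<in> sets borel" using C by (intro borel_closed compact_imp_closed)
  have low_sets: "{u \<in> C. (\<Sum>j<n. p u (\<nu> j)) < real n * \<eta>} \<in> sets borel"
  proof -
    note [measurable] = p_meas C_sets
    show ?thesis by measurable
  qed
  have pstar_sets: "{z. pstar \<nu> n (fst z) (snd z) \<le> \<alpha> + \<epsilon>} \<in> sets (borel \<Otimes>\<^sub>M borel)"
  proof -
    note [measurable] = borel_measurable_pstar
    have "{z \<in> space (borel \<Otimes>\<^sub>M borel). pstar \<nu> n (fst z) (snd z) \<le> \<alpha> + \<epsilon>} \<in> sets (borel \<Otimes>\<^sub>M borel)"
      by measurable
    then show ?thesis by (simp add: space_pair_measure)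
  qed
  let ?d = "\<lambda>u. DBL (post_mean Prior p ?J u) (emp_others \<nu> n i)"
  let ?Q = "PiM ?J (\<lambda>j. Qlaw lam p (\<nu> j))"
  define E1 where "E1 = {\<omega> \<in> space D. \<omega> i \<in> {z. pstar \<nu> n (fst z) (snd z) \<le> \<alpha> + \<epsilon>}}"
  define E2 where "E2 = {\<omega> \<in> space D. \<omega> i \<in> {z. snd z \<in> - C}}"
  define E3 where "E3 = {\<omega> \<in> space D. \<omega> i \<in> {z. snd z \<in> {u \<in> C. (\<Sum>j<n. p u (\<nu> j)) < real n * \<eta>}}}"
  define E4 where "E4 = {\<omega> \<in> space D. \<kappa> \<le> ?d (\<lambda>j. snd (\<omega> j))}"
  have E1: "E1 \<in> sets D" "measure D E1 = measure (data_law lam p F \<theta>0 (\<nu> i)) {z. pstar \<nu> n (fst z) (snd z) \<le> \<alpha> + \<epsilon>}"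
    unfolding E1_def by (intro component pstar_sets)+
  have E2: "E2 \<in> sets D" "measure D E2 = measure (Qlaw lam p (\<nu> i)) (- C)"
    unfolding E2_def using C_sets
    by (simp_all only: component snd_sets measure_data_law_snd borel_comp)
  have E3: "E3 \<in> sets D" "measure D E3 = measure (Qlaw lam p (\<nu> i)) {u \<in> C. (\<Sum>j<n. p u (\<nu> j)) < real n * \<eta>}"
    unfolding E3_def by (simp_all only: component snd_sets measure_data_law_snd low_sets)
  have E4: "E4 \<in> sets D" "measure D E4 \<le> post_err lam p Prior \<nu> n i / \<kappa>"
  proof -
    \<comment> \<open>\<open>E4\<close> depends only on the nuisance data of the other units, so its
      probability can be computed under their product law, where the Markov bound is
      available.\<close>
    let ?X = "\<lambda>\<omega>. \<lambda>j\<in>?J. snd (\<omega> j)"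
    have snd: "snd \<in> data_law lam p F (\<theta> j) (\<nu> j) \<rightarrow>\<^sub>M borel" for j
      by (subst measurable_cong_sets[OF sets_data_law refl]) simp
    have law: "distr D (PiM ?J (\<lambda>_. borel)) ?X = ?Q"
      unfolding D_def using distr_PiM_marginal[of "{..<n}" ?J "\<lambda>j. data_law lam p F (\<theta> j) (\<nu> j)" snd "\<lambda>_. borel"]
      by (simp add: prob_space_data_law snd distr_data_law_snd)
    have X: "?X \<in> D \<rightarrow>\<^sub>M PiM ?J (\<lambda>_. borel)"
      unfolding D_def
    proof (rule measurable_restrict)
      fix j assume "j \<in> ?J"
      then have "(\<lambda>\<omega>. \<omega> j) \<in> PiM {..<n} (\<lambda>j. data_law lam p F (\<theta> j) (\<nu> j))
          \<rightarrow>\<^sub>M data_law lam p F (\<theta> j) (\<nu> j)"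
        by (intro measurable_component_singleton) auto
      from measurable_compose[OF this snd]
      show "(\<lambda>\<omega>. snd (\<omega> j)) \<in> PiM {..<n} (\<lambda>j. data_law lam p F (\<theta> j) (\<nu> j)) \<rightarrow>\<^sub>M borel" .
    qed
    define S where "S = {u \<in> space (PiM ?J (\<lambda>_. borel)). \<kappa> \<le> ?d u}"
    have S: "S \<in> sets (PiM ?J (\<lambda>_. borel))"
      unfolding S_def
      using borel_measurable_DBL_post_mean[of ?J \<nu> n i] by (simp add: borel_measurable_iff_ge)
    have d: "?d (\<lambda>j. snd (\<omega> j)) = ?d (?X \<omega>)" for \<omega> :: "nat \<Rightarrow> real \<times> 'u"
      by (subst post_mean_cong[of ?J _ "?X \<omega>"]) auto
    have eq: "E4 = ?X -` S \<inter> space D"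
      unfolding E4_def S_def d using measurable_space[OF X] by blast
    show "E4 \<in> sets D" unfolding eq by (rule measurable_sets[OF X S])
    have "measure D E4 = measure ?Q S" unfolding eq law[symmetric] by (rule measure_distr[OF X S, symmetric])
    also have "S = {u \<in> space ?Q. \<kappa> \<le> ?d u}"
      unfolding S_def sets_eq_imp_space_eq[OF sets_PiM_Qlaw] ..
    finally show "measure D E4 \<le> post_err lam p Prior \<nu> n i / \<kappa>" using DBL_markov[OF \<kappa>] by simp
  qed
  have "{\<omega> \<in> space D. pval Prior p F \<theta>0 n i (fst (\<omega> i)) (\<lambda>j. snd (\<omega> j)) \<le> \<alpha>} \<subseteq> E1 \<union> E2 \<union> E3 \<union> E4"
  proof
    fix \<omega> assume \<omega>: "\<omega> \<in> {\<omega> \<in> space D. pval Prior p F \<theta>0 n i (fst (\<omega> i)) (\<lambda>j. snd (\<omega> j)) \<le> \<alpha>}"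
    show "\<omega> \<in> E1 \<union> E2 \<union> E3 \<union> E4"
    proof (rule ccontr)
      assume not: "\<omega> \<notin> E1 \<union> E2 \<union> E3 \<union> E4"
      then have "pstar \<nu> n (fst (\<omega> i)) (snd (\<omega> i)) \<le> pval Prior p F \<theta>0 n i (fst (\<omega> i)) (\<lambda>j. snd (\<omega> j)) + \<epsilon>"
        using \<omega> by (intro le) (auto simp: E1_def E2_def E3_def E4_def not_less not_le)
      then show False using \<omega> not by (auto simp: E1_def)
    qed
  qed
  then have "rej_prob lam p F \<theta>0 Prior \<theta> \<nu> n i \<alpha> \<le> measure D (E1 \<union> E2 \<union> E3 \<union> E4)"
    unfolding rej_prob_def Let_def D_def[symmetric]
    using E1 E2 E3 E4 by (intro D.finite_measure_mono) auto
  also have "\<dots> \<le> measure D E1 + measure D E2 + measure D E3 + measure D E4"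
    using measure_Un_le[of "E1 \<union> E2 \<union> E3" D E4] measure_Un_le[of "E1 \<union> E2" D E3] measure_Un_le[of E1 D E2]
      E1 E2 E3 E4 by auto
  finally show ?thesis using E1 E2 E3 E4 by linarith
qed

text \<open>Constants are chosen in the order \<open>C\<close> from tightness, \<open>\<eta>\<close>
  from the reference measure of \<open>C\<close>, then \<open>\<kappa>\<close> and \<open>N\<close>.
  The four \<open>\<epsilon>\<close> are the shift of the level, the mass outside \<open>C\<close>,
  the low-density event and the Markov bound.\<close>

lemma compound_rejection_bound:
  assumes tight: "\<forall>\<epsilon>>0. \<exists>C. compact C \<and> (\<forall>\<nu>. measure (Qlaw lam p \<nu>) (- C) < \<epsilon>)"
    and \<epsilon>: "0 < \<epsilon>" "\<epsilon> \<le> 1"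
  obtains \<rho> N where "0 < \<rho>"
    "\<And>n \<theta> \<nu> \<alpha>. \<lbrakk>N \<le> n; \<And>i. i < n \<Longrightarrow> post_err lam p Prior \<nu> n i \<le> \<rho>; 0 \<le> \<alpha>\<rbrakk>
      \<Longrightarrow> (\<Sum>i\<in>{i. i < n \<and> \<theta> i = \<theta>0}. rej_prob lam p F \<theta>0 Prior \<theta> \<nu> n i \<alpha>) \<le> real n * (\<alpha> + 4 * \<epsilon>)"
proof -
  obtain C where C: "compact C" "\<And>\<nu>. measure (Qlaw lam p \<nu>) (- C) < \<epsilon>" using tight \<epsilon>(1) by blast
  \<comment> \<open>The summand 1 avoids division by zero when \<open>C\<close> is a null set of
    \<open>lam\<close>.\<close>
  define \<eta> where "\<eta> = \<epsilon> / (1 + measure lam C)"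
  have \<eta>: "0 < \<eta>" "\<eta> * measure lam C \<le> \<epsilon>"
    using \<epsilon>(1) measure_nonneg[of lam C] by (auto simp: \<eta>_def field_simps add_pos_nonneg)
  show thesis
  proof (rule pstar_le_pval[OF C(1) \<epsilon> \<eta>(1)])
    fix \<kappa> N
    assume \<kappa>: "0 < \<kappa>" and le: "\<And>n i \<nu> t u. \<lbrakk>N \<le> n; i < n; u i \<in> C; real n * \<eta> \<le> (\<Sum>j<n. p (u i) (\<nu> j));
        DBL (post_mean Prior p ({..<n} - {i}) u) (emp_others \<nu> n i) < \<kappa>\<rbrakk>
      \<Longrightarrow> pstar \<nu> n t (u i) \<le> pval Prior p F \<theta>0 n i t u + \<epsilon>"
    show thesis
    \<comment> \<open>With this tolerance the Markov term
      \<open>post_err lam p Prior \<nu> n i / \<kappa>\<close> is at most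
      \<open>\<epsilon>\<close>.\<close>
    proof (rule that[of "\<kappa> * \<epsilon>" N])
      show "0 < \<kappa> * \<epsilon>" using \<kappa> \<epsilon> by simp
      fix n \<theta> \<nu> and \<alpha> :: real
      assume n: "N \<le> n" and err: "\<And>i. i < n \<Longrightarrow> post_err lam p Prior \<nu> n i \<le> \<kappa> * \<epsilon>" and \<alpha>: "0 \<le> \<alpha>"
      let ?f1 = "\<lambda>i. measure (data_law lam p F \<theta>0 (\<nu> i)) {z. pstar \<nu> n (fst z) (snd z) \<le> \<alpha> + \<epsilon>}"
      let ?f3 = "\<lambda>i. measure (Qlaw lam p (\<nu> i)) {u \<in> C. (\<Sum>j<n. p u (\<nu> j)) < real n * \<eta>}"
      have "(\<Sum>i\<in>{i. i < n \<and> \<theta> i = \<theta>0}. rej_prob lam p F \<theta>0 Prior \<theta> \<nu> n i \<alpha>)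
          \<le> (\<Sum>i\<in>{i. i < n \<and> \<theta> i = \<theta>0}. ?f1 i + \<epsilon> + ?f3 i + \<epsilon>)"
      proof (rule sum_mono)
        fix i assume "i \<in> {i. i < n \<and> \<theta> i = \<theta>0}"
        then have i: "i < n" "\<theta> i = \<theta>0" by auto
        have "rej_prob lam p F \<theta>0 Prior \<theta> \<nu> n i \<alpha>
            \<le> ?f1 i + measure (Qlaw lam p (\<nu> i)) (- C) + ?f3 i + post_err lam p Prior \<nu> n i / \<kappa>"
          by (rule rej_prob_le[where n=n and i=i and \<theta>=\<theta> and \<nu>=\<nu> and \<eta>=\<eta> and \<epsilon>=\<epsilon>, OF i C(1) \<kappa>]) (rule le[OF n i(1)])
        moreover have "post_err lam p Prior \<nu> n i / \<kappa> \<le> \<epsilon>" using err[OF i(1)] \<kappa> by (simp add: field_simps)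
        ultimately show "rej_prob lam p F \<theta>0 Prior \<theta> \<nu> n i \<alpha> \<le> ?f1 i + \<epsilon> + ?f3 i + \<epsilon>"
          using C(2)[of "\<nu> i"] by linarith
      qed
      \<comment> \<open>The sum may be enlarged from the null units to all units: the summands are
        nonnegative and already refer to the null law at \<open>\<theta>0\<close>, so
        \<open>compound_pstar\<close> applies.\<close>
      also have "\<dots> \<le> (\<Sum>i<n. ?f1 i + \<epsilon> + ?f3 i + \<epsilon>)"
        using \<epsilon> by (intro sum_mono2) auto
      also have "\<dots> = (\<Sum>i<n. ?f1 i) + (\<Sum>i<n. ?f3 i) + real n * (2 * \<epsilon>)"
        by (simp add: sum.distrib)
      also have "\<dots> \<le> real n * (\<alpha> + \<epsilon>) + real n * \<epsilon> + real n * (2 * \<epsilon>)"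
      proof (intro add_mono order_refl)
        show "(\<Sum>i<n. ?f1 i) \<le> real n * (\<alpha> + \<epsilon>)" using \<alpha> \<epsilon> by (intro compound_pstar) auto
        have "(\<Sum>i<n. ?f3 i) \<le> real n * (\<eta> * measure lam C)"
          using \<eta>(1) by (intro low_density_bound C) auto
        also have "\<dots> \<le> real n * \<epsilon>" using \<eta>(2) by (intro mult_left_mono) auto
        finally show "(\<Sum>i<n. ?f3 i) \<le> real n * \<epsilon>" .
      qed
      also have "\<dots> = real n * (\<alpha> + 4 * \<epsilon>)" by (simp add: algebra_simps)
      finally show "(\<Sum>i\<in>{i. i < n \<and> \<theta> i = \<theta>0}. rej_prob lam p F \<theta>0 Prior \<theta> \<nu> n i \<alpha>) \<le> real n * (\<alpha> + 4 * \<epsilon>)" .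
    qed
  qed
qed

end

section \<open>Passage to the limit in the number of units\<close>

theorem theorem4:
  fixes lam :: "'u::metric_space measure"
    and p :: "'u \<Rightarrow> 'v::metric_space \<Rightarrow> real"
    and F :: "'th \<Rightarrow> 'v \<Rightarrow> 'u \<Rightarrow> real measure"
    and \<theta>0 :: 'th
    and Prior :: "'v measure measure"
    and \<theta>s :: "nat \<Rightarrow> nat \<Rightarrow> 'th"
    and \<nu>s :: "nat \<Rightarrow> nat \<Rightarrow> 'v"
  assumes kernel: "\<And>\<theta> \<nu>. (\<lambda>u. F \<theta> \<nu> u) \<in> borel \<rightarrow>\<^sub>M prob_algebra borel"
    and lam_sets: "sets lam = sets (borel :: 'u measure)"
    and p_nonneg: "\<And>u \<nu>. 0 \<le> p u \<nu>"
    and p_meas: "\<And>\<nu>. (\<lambda>u. p u \<nu>) \<in> borel_measurable borel"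
    and Q_prob: "\<And>\<nu>. prob_space (Qlaw lam p \<nu>)"
    and Pi_sets: "sets Prior = sets (prob_algebra (borel :: 'v measure))"
    and Pi_prob: "prob_space Prior"
    and A1: "\<And>\<nu> u. absolutely_continuous lborel (F \<theta>0 \<nu> u)"
    and A2: "compact (UNIV :: 'v set)"
    and A3: "\<forall>\<epsilon>>0. \<exists>\<delta>>0. \<forall>t u \<nu> \<nu>'. dist \<nu> \<nu>' < \<delta> \<longrightarrow>
                 \<bar>Por F \<theta>0 t u \<nu> - Por F \<theta>0 t u \<nu>'\<bar> < \<epsilon>"
    and A4_tight: "\<forall>\<epsilon>>0. \<exists>C. compact C \<and> (\<forall>\<nu>. measure (Qlaw lam p \<nu>) (- C) < \<epsilon>)"
    and A4_fin: "\<And>C. compact C \<Longrightarrow> emeasure lam C < \<infinity>"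
    and A4_bdd: "\<And>C. compact C \<Longrightarrow> \<exists>B. \<forall>u\<in>C. \<forall>\<nu>. \<bar>p u \<nu>\<bar> \<le> B"
    and A4_eqc: "\<And>C. compact C \<Longrightarrow> \<forall>\<epsilon>>0. \<exists>\<delta>>0. \<forall>u\<in>C. \<forall>\<nu> \<nu>'.
                   dist \<nu> \<nu>' < \<delta> \<longrightarrow> \<bar>p u \<nu> - p u \<nu>'\<bar> < \<epsilon>"
    and conv: "(\<lambda>n. Max ((\<lambda>i. post_err lam p Prior (\<nu>s n) n i) ` {..<n})) \<longlonglongrightarrow> 0"
  shows "limsup (\<lambda>n. ereal (SUP \<alpha>\<in>{0..1}.
            max 0 ((\<Sum>i\<in>{i. i < n \<and> \<theta>s n i = \<theta>0}. rej_prob lam p F \<theta>0 Prior (\<theta>s n) (\<nu>s n) n i \<alpha>) / real n - \<alpha>)))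
         \<le> 0"
proof -
  interpret hierarchical_model lam p F \<theta>0 Prior
    by (rule hierarchical_model.intro) (fact assms)+
  let ?S = "\<lambda>n. SUP \<alpha>\<in>{0..1}. max 0 ((\<Sum>i\<in>{i. i < n \<and> \<theta>s n i = \<theta>0}.
    rej_prob lam p F \<theta>0 Prior (\<theta>s n) (\<nu>s n) n i \<alpha>) / real n - \<alpha>)"
  have bound: "limsup (\<lambda>n. ereal (?S n)) \<le> ereal (4 * \<epsilon>)" if \<epsilon>: "0 < \<epsilon>" "\<epsilon> \<le> 1" for \<epsilon>
  proof -
    show ?thesis
    proof (rule compound_rejection_bound[OF A4_tight \<epsilon>])
      fix \<rho> N
      assume \<rho>: "0 < \<rho>" and le:
        "\<And>n \<theta> \<nu> \<alpha>. \<lbrakk>N \<le> n; \<And>i. i < n \<Longrightarrow> post_err lam p Prior \<nu> n i \<le> \<rho>; 0 \<le> \<alpha>\<rbrakk>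
          \<Longrightarrow> (\<Sum>i\<in>{i. i < n \<and> \<theta> i = \<theta>0}. rej_prob lam p F \<theta>0 Prior \<theta> \<nu> n i \<alpha>) \<le> real n * (\<alpha> + 4 * \<epsilon>)"
      have "eventually (\<lambda>n. Max ((\<lambda>i. post_err lam p Prior (\<nu>s n) n i) ` {..<n}) < \<rho>) sequentially"
        using conv \<rho> by (rule order_tendstoD)
      moreover have "eventually (\<lambda>n. max 1 N \<le> n) sequentially" by (rule eventually_ge_at_top)
      ultimately have "eventually (\<lambda>n. ereal (?S n) \<le> ereal (4 * \<epsilon>)) sequentially"
      proof eventually_elim
        case (elim n)
        have err: "post_err lam p Prior (\<nu>s n) n i \<le> \<rho>" if "i < n" for i
        proof -
          have "post_err lam p Prior (\<nu>s n) n i \<le> Max ((\<lambda>i. post_err lam p Prior (\<nu>s n) n i) ` {..<n})"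
            by (rule Max_ge) (use that in auto)
          then show ?thesis using elim(1) by linarith
        qed
        \<comment> \<open>The excess over \<open>\<alpha>\<close> has a bound free of
          \<open>\<alpha>\<close>, so it passes to the supremum; positivity of
          \<open>\<epsilon>\<close> takes care of the positive part.\<close>
        have "?S n \<le> 4 * \<epsilon>"
        proof (rule cSUP_least)
          fix \<alpha> :: real assume "\<alpha> \<in> {0..1}"
          then show "max 0 ((\<Sum>i\<in>{i. i < n \<and> \<theta>s n i = \<theta>0}.
              rej_prob lam p F \<theta>0 Prior (\<theta>s n) (\<nu>s n) n i \<alpha>) / real n - \<alpha>) \<le> 4 * \<epsilon>"
            using le[of n "\<nu>s n" \<alpha> "\<theta>s n"] err elim(2) \<epsilon> by (simp add: field_simps)
        qed simp
        then show ?case by simp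
      qed
      then show ?thesis by (rule Limsup_bounded)
    qed
  qed
  show ?thesis
  proof (rule ereal_le_epsilon2)
    fix e :: real assume e: "0 < e"
    \<comment> \<open>Capped at 1 because the comparison of p-values is stated for such
      \<open>\<epsilon>\<close>; the quarter absorbs the factor 4.\<close>
    define \<epsilon> where "\<epsilon> = min 1 (e / 4)"
    have "limsup (\<lambda>n. ereal (?S n)) \<le> ereal (4 * \<epsilon>)" using e by (intro bound) (auto simp: \<epsilon>_def)
    also have "\<dots> \<le> 0 + ereal e" by (simp add: \<epsilon>_def)
    finally show "limsup (\<lambda>n. ereal (?S n)) \<le> 0 + ereal e" .
  qed
qed

end
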